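(* Let $\mathbf Y$ be a collection of metric graphs with projections $\{\pi_Y\}$ and constant $\theta$ as in the context, let $K\ge4\theta$, and let $\mathcal C_K(\mathbf Y)$ be the associated quasi-tree of metric spaces. Let $G$ be a group acting isometrically on the disjoint union of the elements of $\mathbf Y$, permuting the elements of $\mathbf Y$, with $\pi_{gX}(gY)=g(\pi_X(Y))$ for all $g\in G$ and $X\neq Y$ in $\mathbf Y$, so that $G$ acts isometrically on $\mathcal C_K(\mathbf Y)$. Assume that for each $Y\in\mathbf Y$ the stabilizer of $Y$ in $G$ acts acylindrically on $Y$ with uniform constants independent of $Y$. Furthermore assume that for some fixed $N$ and $B$, for any $N$ distinct elements of $\mathbf Y$ the common stabilizer is a finite subgroup of size at most $B$. Then the action of $G$ on $\mathcal C_K(\mathbf Y)$ is acylindrical.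
   Context: Setting. $\mathbf Y=\{(Y,\rho_Y)\}$ is a collection of connected graphs, each with its path metric with edges of length one. For all $X\ne Y$ in $\mathbf Y$ there is a nonempty set of vertices $\pi_Y(X)\subseteq Y$, and $d_Y(X,Z)=\operatorname{diam}(\pi_Y(X)\cup\pi_Y(Z))$ for $X,Z\in\mathbf Y\setminus\{Y\}$. There is an integer $\theta\ge0$ such that: - $d_Y(X,X)\le\theta$ for $X\neq Y$; - (P1') for pairwise distinct $X,Y,Z$: if $d_Y(X,Z)>\theta$ then $\pi_X(Y)=\pi_X(Z)$; - for all $X,Z\in\mathbf Y$ the set $\{Y\in\mathbf Y\setminus\{X,Z\}:d_Y(X,Z)>\theta\}$ is finite. (Consequently $d_Y$ is symmetric, satisfies the triangle inequality, and if $d_Y(X,Z)>\theta$ then $d_Z(X,W)=d_Z(Y,W)$ for all $W\ne Z$.) $K>0$ is an integer. $\mathcal P_K(\mathbf Y)$ is the graph with vertex set $\mathbf Y$ with distinct $X,Z$ adjacent iff $d_Y(X,Z)\le K$ for all $Y\in\mathbf Y\setminus\{X,Z\}$. The quasi-tree of metric spaces $\mathcal C_K(\mathbf Y)$ is obtained from the disjoint union of the graphs in $\mathbf Y$ by adding, for each pair $X,Y$ adjacent in $\mathcal P_K(\mathbf Y)$, an edge of length $K$ connecting every point of $\pi_Y(X)$ to every point of $\pi_X(Y)$; it carries the induced path metric. An isometric action of a group $H$ on a metric space $\mathcal X$ is acylindrical if for all $D>0$ there exist $L>0$ and $B'>0$ such that whenever $d_{\mathcal X}(x,y)\ge L$,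 there are at most $B'$ elements $h\in H$ with $d_{\mathcal X}(x,hx)\le D$ and $d_{\mathcal X}(y,hy)\le D$. "With uniform constants independent of $Y$" means that for each $D$ the same $L,B'$ work for all $Y\in\mathbf Y$. The common stabilizer of several elements of $\mathbf Y$ is the subgroup of elements mapping each of them to itself. *)

theory Defs
  imports
    "HOL-Analysis.Abstract_Metric_Spaces"
    "HOL-Library.Extended_Nonnegative_Real"
    "HOL-Algebra.Group_Action"
    "Graph_Theory.Bidirected_Digraph"
    "Graph_Theory.Digraph_Component"
begin

section \<open>Metric graphs\<close>

text \<open>
  Graphs are graphs in the sense of Serre: every geometric edge is a pair of opposite arcs
  \<open>a\<close>, \<open>reversal a\<close>, so loops and multiple edges are allowed. The metric space is the
  geometric realization. The point at distance \<open>t\<close> from the tail along the arc \<open>a\<close> is also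
  the point at distance \<open>len a - t\<close> from the tail along the reversed arc; an interior point of
  an edge is represented by the set of these two descriptions.
\<close>

record ('v, 'e) metric_graph =
  digraph :: "('v, 'e) pre_digraph"
  reversal :: "'e \<Rightarrow> 'e"
  len :: "'e \<Rightarrow> real"

datatype ('v, 'e) point = Vertex 'v | Interior "('e \<times> real) set"

definition edge_point :: "('v, 'e) metric_graph \<Rightarrow> 'e \<Rightarrow> real \<Rightarrow> ('v, 'e) point" where
  "edge_point \<Gamma> a t =
     (if t = 0 then Vertex (tail (digraph \<Gamma>) a)
      else if t = len \<Gamma> a then Vertex (head (digraph \<Gamma>) a)
      else Interior {(a, t), (reversal \<Gamma> a, len \<Gamma> a - t)})"

definition realization :: "('v, 'e) metric_graph \<Rightarrow> ('v, 'e) point set" where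
  "realization \<Gamma> = Vertex ` verts (digraph \<Gamma>) \<union>
     {edge_point \<Gamma> a t | a t. a \<in> arcs (digraph \<Gamma>) \<and> 0 \<le> t \<and> t \<le> len \<Gamma> a}"

text \<open>
  \<open>pl_path \<Gamma> x y l\<close>: some piecewise linear path from \<open>x\<close> to \<open>y\<close>, that is, a concatenation of
  finitely many segments each contained in a closed edge, has length \<open>l\<close>.
\<close>

inductive pl_path :: "('v, 'e) metric_graph \<Rightarrow> ('v, 'e) point \<Rightarrow> ('v, 'e) point \<Rightarrow> real \<Rightarrow> bool"
  for \<Gamma> where
  refl: "x \<in> realization \<Gamma> \<Longrightarrow> pl_path \<Gamma> x x 0"
| step: "\<lbrakk>a \<in> arcs (digraph \<Gamma>); s \<in> {0..len \<Gamma> a}; t \<in> {0..len \<Gamma> a};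
          pl_path \<Gamma> (edge_point \<Gamma> a t) y l\<rbrakk>
         \<Longrightarrow> pl_path \<Gamma> (edge_point \<Gamma> a s) y (\<bar>s - t\<bar> + l)"

text \<open>
  The value \<open>0\<close> for points not joined by a path is a dummy: it does not occur between points
  of a connected graph.
\<close>

definition path_dist :: "('v, 'e) metric_graph \<Rightarrow> ('v, 'e) point \<Rightarrow> ('v, 'e) point \<Rightarrow> real" where
  "path_dist \<Gamma> x y = (if \<exists>l. pl_path \<Gamma> x y l then Inf {l. pl_path \<Gamma> x y l} else 0)"

definition connected_unit_graph :: "('v, 'e) metric_graph \<Rightarrow> bool" where
  "connected_unit_graph \<Gamma> \<longleftrightarrow>
     bidirected_digraph (digraph \<Gamma>) (reversal \<Gamma>) \<and>
     Digraph_Component.connected (digraph \<Gamma>) \<and>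
     (\<forall>a\<in>arcs (digraph \<Gamma>). len \<Gamma> a = 1)"


section \<open>Projections\<close>

text \<open>
  The collection is an indexed family; \<open>proj \<Y> Y X\<close> is the set of vertices $\pi_Y(X)$ of the
  graph indexed by \<open>Y\<close>.
\<close>

record ('i, 'v, 'e) graph_family =
  members :: "'i set"
  graph :: "'i \<Rightarrow> ('v, 'e) metric_graph"
  proj :: "'i \<Rightarrow> 'i \<Rightarrow> 'v set"

text \<open>Extended-valued, so that a bound on the diameter of a set entails that the set is bounded.\<close>

definition diam :: "('a \<Rightarrow> 'a \<Rightarrow> real) \<Rightarrow> 'a set \<Rightarrow> ennreal" where
  "diam d S = (SUP x\<in>S. SUP y\<in>S. ennreal (d x y))"

definition proj_dist :: "('i, 'v, 'e) graph_family \<Rightarrow> 'i \<Rightarrow> 'i \<Rightarrow> 'i \<Rightarrow> ennreal" where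
  "proj_dist \<Y> Y X Z = diam (path_dist (graph \<Y> Y)) (Vertex ` (proj \<Y> Y X \<union> proj \<Y> Y Z))"

locale projection_family =
  fixes \<Y> :: "('i, 'v, 'e) graph_family" and \<theta> :: nat
  assumes graphs: "Y \<in> members \<Y> \<Longrightarrow> connected_unit_graph (graph \<Y> Y)"
    and proj_nonempty: "\<lbrakk>X \<in> members \<Y>; Y \<in> members \<Y>; X \<noteq> Y\<rbrakk> \<Longrightarrow> proj \<Y> Y X \<noteq> {}"
    and proj_vertices: "\<lbrakk>X \<in> members \<Y>; Y \<in> members \<Y>; X \<noteq> Y\<rbrakk>
           \<Longrightarrow> proj \<Y> Y X \<subseteq> verts (digraph (graph \<Y> Y))"
    and proj_diam: "\<lbrakk>X \<in> members \<Y>; Y \<in> members \<Y>; X \<noteq> Y\<rbrakk> \<Longrightarrow> proj_dist \<Y> Y X X \<le> of_nat \<theta>"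
    and P1': "\<lbrakk>X \<in> members \<Y>; Y \<in> members \<Y>; Z \<in> members \<Y>; X \<noteq> Y; X \<noteq> Z; Y \<noteq> Z;
              proj_dist \<Y> Y X Z > of_nat \<theta>\<rbrakk> \<Longrightarrow> proj \<Y> X Y = proj \<Y> X Z"
    and finite_large: "\<lbrakk>X \<in> members \<Y>; Z \<in> members \<Y>\<rbrakk>
           \<Longrightarrow> finite {Y \<in> members \<Y> - {X, Z}. proj_dist \<Y> Y X Z > of_nat \<theta>}"


section \<open>The quasi-tree of metric spaces\<close>

text \<open>Adjacency in the projection complex $\mathcal P_K(\mathbf Y)$.\<close>

definition proj_complex_adj :: "('i, 'v, 'e) graph_family \<Rightarrow> nat \<Rightarrow> 'i \<Rightarrow> 'i \<Rightarrow> bool" where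
  "proj_complex_adj \<Y> K X Z \<longleftrightarrow> X \<in> members \<Y> \<and> Z \<in> members \<Y> \<and> X \<noteq> Z \<and>
     (\<forall>Y\<in>members \<Y> - {X, Z}. proj_dist \<Y> Y X Z \<le> of_nat K)"

text \<open>
  Arcs of the quasi-tree: \<open>Old (Y, a)\<close> is the arc \<open>a\<close> of the graph \<open>Y\<close>, and \<open>Bridge u w\<close> is the
  added arc from the vertex \<open>u\<close> to the vertex \<open>w\<close> (both in the disjoint union). The two arcs
  \<open>Bridge u w\<close> and \<open>Bridge w u\<close> form a single added edge.
\<close>

datatype ('c, 'w) qt_arc = Old 'c | Bridge 'w 'w

definition qt_digraph ::
  "('i, 'v, 'e) graph_family \<Rightarrow> nat \<Rightarrow> ('i \<times> 'v, ('i \<times> 'e, 'i \<times> 'v) qt_arc) pre_digraph" where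
  "qt_digraph \<Y> K = \<lparr>
     verts = (SIGMA Y:members \<Y>. verts (digraph (graph \<Y> Y))),
     arcs = Old ` (SIGMA Y:members \<Y>. arcs (digraph (graph \<Y> Y))) \<union>
       {Bridge (Y, p) (X, q) | X Y p q.
          proj_complex_adj \<Y> K X Y \<and> p \<in> proj \<Y> Y X \<and> q \<in> proj \<Y> X Y},
     tail = (\<lambda>b. case b of Old (Y, a) \<Rightarrow> (Y, tail (digraph (graph \<Y> Y)) a) | Bridge u w \<Rightarrow> u),
     head = (\<lambda>b. case b of Old (Y, a) \<Rightarrow> (Y, head (digraph (graph \<Y> Y)) a) | Bridge u w \<Rightarrow> w)\<rparr>"

definition quasi_tree ::
  "('i, 'v, 'e) graph_family \<Rightarrow> nat \<Rightarrow> ('i \<times> 'v, ('i \<times> 'e, 'i \<times> 'v) qt_arc) metric_graph" where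
  "quasi_tree \<Y> K = \<lparr>
     digraph = qt_digraph \<Y> K,
     reversal = (\<lambda>b. if b \<in> arcs (qt_digraph \<Y> K)
       then (case b of Old (Y, a) \<Rightarrow> Old (Y, reversal (graph \<Y> Y) a) | Bridge u w \<Rightarrow> Bridge w u)
       else b),
     len = (\<lambda>b. case b of Old (Y, a) \<Rightarrow> len (graph \<Y> Y) a | Bridge u w \<Rightarrow> real K)\<rparr>"


section \<open>Group actions\<close>

locale isometric_action = Metric_space M d + group_action G M \<psi>
  for G :: "('g, 'm) monoid_scheme" and M :: "'a set" and d :: "'a \<Rightarrow> 'a \<Rightarrow> real"
    and \<psi> :: "'g \<Rightarrow> 'a \<Rightarrow> 'a" +
  assumes isometry:
    "\<lbrakk>g \<in> carrier G; x \<in> M; y \<in> M\<rbrakk> \<Longrightarrow> d (\<psi> g x) (\<psi> g y) = d x y"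

text \<open>
  A family of sets \<open>H i\<close> of group elements acting on \<open>(M i, d i)\<close> through \<open>\<psi> i\<close>, with the
  constants in the acylindricity condition not depending on \<open>i\<close>.
\<close>

definition uniformly_acylindrical ::
  "'i set \<Rightarrow> ('i \<Rightarrow> 'g set) \<Rightarrow> ('i \<Rightarrow> 'a set) \<Rightarrow> ('i \<Rightarrow> 'a \<Rightarrow> 'a \<Rightarrow> real)
     \<Rightarrow> ('i \<Rightarrow> 'g \<Rightarrow> 'a \<Rightarrow> 'a) \<Rightarrow> bool" where
  "uniformly_acylindrical I H M d \<psi> \<longleftrightarrow>
     (\<forall>D>0. \<exists>L>0. \<exists>B'>0. \<forall>i\<in>I. \<forall>x\<in>M i. \<forall>y\<in>M i. d i x y \<ge> L \<longrightarrow>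
        finite {h \<in> H i. d i x (\<psi> i h x) \<le> D \<and> d i y (\<psi> i h y) \<le> D} \<and>
        card {h \<in> H i. d i x (\<psi> i h x) \<le> D \<and> d i y (\<psi> i h y) \<le> D} \<le> (B' :: nat))"

definition acylindrical_action ::
  "('g, 'm) monoid_scheme \<Rightarrow> 'a set \<Rightarrow> ('a \<Rightarrow> 'a \<Rightarrow> real) \<Rightarrow> ('g \<Rightarrow> 'a \<Rightarrow> 'a) \<Rightarrow> bool" where
  "acylindrical_action G M d \<psi> \<longleftrightarrow>
     isometric_action G M d \<psi> \<and>
     uniformly_acylindrical {()} (\<lambda>_. carrier G) (\<lambda>_. M) (\<lambda>_. d) (\<lambda>_. \<psi>)"

definition disjoint_union :: "('i, 'v, 'e) graph_family \<Rightarrow> ('i \<times> ('v, 'e) point) set" where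
  "disjoint_union \<Y> = (SIGMA Y:members \<Y>. realization (graph \<Y> Y))"

text \<open>
  \<open>\<phi>\<close> is the action on the disjoint union and \<open>\<alpha>\<close> the induced permutation action on the members.
  Elements of \<open>G\<close> are only required to be isometries between the metric spaces; they need not
  come from graph isomorphisms (think of small rotations of a circle).
\<close>

locale projection_family_action =
  fixes G :: "('g, 'm) monoid_scheme" and \<Y> :: "('i, 'v, 'e) graph_family"
    and \<alpha> :: "'g \<Rightarrow> 'i \<Rightarrow> 'i"
    and \<phi> :: "'g \<Rightarrow> 'i \<times> ('v, 'e) point \<Rightarrow> 'i \<times> ('v, 'e) point"
  assumes members_action: "group_action G (members \<Y>) \<alpha>"
    and points_action: "group_action G (disjoint_union \<Y>) \<phi>"
    and permutes_members:
      "\<lbrakk>g \<in> carrier G; (Y, x) \<in> disjoint_union \<Y>\<rbrakk> \<Longrightarrow> fst (\<phi> g (Y, x)) = \<alpha> g Y"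
    and isometric:
      "\<lbrakk>g \<in> carrier G; (Y, x) \<in> disjoint_union \<Y>; (Y, y) \<in> disjoint_union \<Y>\<rbrakk>
       \<Longrightarrow> path_dist (graph \<Y> (\<alpha> g Y)) (snd (\<phi> g (Y, x))) (snd (\<phi> g (Y, y)))
           = path_dist (graph \<Y> Y) x y"
    and equivariant:
      "\<lbrakk>g \<in> carrier G; X \<in> members \<Y>; Y \<in> members \<Y>; X \<noteq> Y\<rbrakk>
       \<Longrightarrow> (\<lambda>p. (\<alpha> g X, Vertex p)) ` proj \<Y> (\<alpha> g X) (\<alpha> g Y)
           = (\<lambda>p. \<phi> g (X, Vertex p)) ` proj \<Y> X Y"

text \<open>The inclusion of the disjoint union into the quasi-tree.\<close>

fun qt_incl :: "'i \<times> ('v, 'e) point \<Rightarrow> ('i \<times> 'v, ('i \<times> 'e, 'i \<times> 'v) qt_arc) point" where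
  "qt_incl (Y, Vertex v) = Vertex (Y, v)"
| "qt_incl (Y, Interior S) = Interior ((\<lambda>(a, t). (Old (Y, a), t)) ` S)"

text \<open>
  The induced action on the quasi-tree: \<open>\<phi>\<close> on the disjoint union, and the linear extension over
  the interiors of the added edges. The endpoints of added edges lie in projections, hence are
  mapped to vertices by equivariance; only for such vertices is \<open>vertex_image\<close> meaningful.
\<close>

definition vertex_image ::
  "('g \<Rightarrow> 'i \<times> ('v, 'e) point \<Rightarrow> 'i \<times> ('v, 'e) point) \<Rightarrow> 'g \<Rightarrow> 'i \<times> 'v \<Rightarrow> 'i \<times> 'v" where
  "vertex_image \<phi> g u =
     (THE w. \<phi> g (fst u, Vertex (snd u)) = (fst w, Vertex (snd w)))"

definition qt_action ::
  "('i, 'v, 'e) graph_family \<Rightarrow> nat \<Rightarrow> ('g \<Rightarrow> 'i \<times> ('v, 'e) point \<Rightarrow> 'i \<times> ('v, 'e) point)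
     \<Rightarrow> 'g \<Rightarrow> ('i \<times> 'v, ('i \<times> 'e, 'i \<times> 'v) qt_arc) point
     \<Rightarrow> ('i \<times> 'v, ('i \<times> 'e, 'i \<times> 'v) qt_arc) point" where
  "qt_action \<Y> K \<phi> g = (\<lambda>x\<in>realization (quasi_tree \<Y> K).
     if x \<in> qt_incl ` disjoint_union \<Y>
     then qt_incl (\<phi> g (inv_into (disjoint_union \<Y>) qt_incl x))
     else (case x of
         Vertex u \<Rightarrow> Vertex u
       | Interior S \<Rightarrow> Interior ((\<lambda>(b, t). (map_qt_arc id (vertex_image \<phi> g) b, t)) ` S)))"

end

theory Submission
  imports Defs
begin

text \<open>
  Write $\pi_U(x)$ for $\{x\}$ if $x \in U$ and for $\pi_U(X)$ if $x \in X \neq U$. A bridge has length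
  $K$ and moves every projection by at most $K$, so $x \mapsto \pi_U(x)$ is coarsely 1-Lipschitz on the
  quasi-tree. The set of $U$ with $d_U(X,Z) > K$ is finite and linearly ordered, the position of
  $U$ being the number of elements separating it from $X$; this number changes by at most 2 when
  $X$ is replaced by a neighbour in the projection complex.

  Let $h$ move $x \in X$ and $z \in Z$ by at most $D$. If $d_W(x,z)$ is very large for some $W$, then $hW$ still
  has large projection distance and almost the same position, so there are boundedly many
  possibilities for $hW$; two elements with the same value of $hW$ differ by an element of the stabilizer
  of $W$ moving two distant points of $W$ a bounded amount, and acylindricity of the
  stabilizer applies. If no projection distance is large, then a large distance between $x$ and
  $z$ forces many elements separating $X$ from $Z$. Those far from both ends again separate $X$ from $Z$ after
  applying $h$, with almost the same position; choosing $N$ of them, there are boundedly many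
  possibilities for their images, and two elements with the same images differ by an element of the
  common stabilizer.
\<close>

section \<open>Path metrics on metric graphs\<close>

text \<open>No geodesic of the quasi-tree is ever analysed. Lower bounds on its metric come from
  functions that are 1-Lipschitz on every piece and change by at most \<open>K\<close> across a
  bridge; upper bounds come from explicit paths cut at separators (\<open>qdist_le\<close>). The
  upper bound is what makes the dichotomy work: with few separators and all projection distances at
  most \<open>R\<close>, the distance is bounded. It doubles at each cut, so it is exponential in
  the number of separators; acylindricity only asks for some constant. The linear order enters
  through positions: an injective natural-number position turns control up to an additive error into
  a bounded number of candidates. Comparisons of separators lose no constant, because (P1') upgrades
  a distance above \<theta> to an equality of projections, so that a distance above \<open>K\<close>
  is recovered exactly. A further obstacle is that group elements are isometries between pieces and
  need not carry edges to edges; the action on the quasi-tree is shown to be isometric through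
  lengths of segments, not through graph automorphisms.\<close>

lemma vertex_in_realization: "v \<in> verts (digraph \<Gamma>) \<Longrightarrow> Vertex v \<in> realization \<Gamma>"
  by (simp add: realization_def)

lemma edge_point_in_realization:
  "\<lbrakk>a \<in> arcs (digraph \<Gamma>); 0 \<le> t; t \<le> len \<Gamma> a\<rbrakk> \<Longrightarrow> edge_point \<Gamma> a t \<in> realization \<Gamma>"
  by (auto simp: realization_def)

lemma edge_point_0 [simp]: "edge_point \<Gamma> a 0 = Vertex (tail (digraph \<Gamma>) a)"
  by (simp add: edge_point_def)

lemma pl_path_nonneg: "pl_path \<Gamma> x y l \<Longrightarrow> 0 \<le> l"
  by (induction rule: pl_path.induct) auto

lemma pl_path_trans: "\<lbrakk>pl_path \<Gamma> x y l; pl_path \<Gamma> y z m\<rbrakk> \<Longrightarrow> pl_path \<Gamma> x z (l + m)"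
proof (induction rule: pl_path.induct)
  case (step a s t y l)
  then show ?case
    using pl_path.step[of a \<Gamma> s t z "l + m"] by (simp add: add.assoc)
qed simp

lemma pl_path_edge:
  assumes "a \<in> arcs (digraph \<Gamma>)" "s \<in> {0..len \<Gamma> a}" "t \<in> {0..len \<Gamma> a}"
  shows "pl_path \<Gamma> (edge_point \<Gamma> a s) (edge_point \<Gamma> a t) \<bar>s - t\<bar>"
  using pl_path.step[OF assms pl_path.refl[of "edge_point \<Gamma> a t"]] assms
  by (simp add: edge_point_in_realization)

lemma pl_path_sym: "pl_path \<Gamma> x y l \<Longrightarrow> pl_path \<Gamma> y x l"
proof (induction rule: pl_path.induct)
  case (step a s t y l)
  then show ?case
    using pl_path_trans[OF step.IH pl_path_edge[of a \<Gamma> t s]]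
    by (simp add: abs_minus_commute add.commute)
qed (rule pl_path.refl)

lemma path_dist_le: "pl_path \<Gamma> x y l \<Longrightarrow> path_dist \<Gamma> x y \<le> l"
  unfolding path_dist_def by (auto intro!: cInf_lower bdd_belowI[of _ 0] dest: pl_path_nonneg)

lemma path_dist_nonneg [simp]: "0 \<le> path_dist \<Gamma> x y"
  unfolding path_dist_def by (auto intro!: cInf_greatest dest: pl_path_nonneg)

lemma path_dist_commute: "path_dist \<Gamma> x y = path_dist \<Gamma> y x"
proof -
  have "pl_path \<Gamma> x y = pl_path \<Gamma> y x"
    using pl_path_sym by blast
  then show ?thesis
    by (simp add: path_dist_def)
qed

lemma path_dist_edge:
  "\<lbrakk>a \<in> arcs (digraph \<Gamma>); s \<in> {0..len \<Gamma> a}; t \<in> {0..len \<Gamma> a}\<rbrakk>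
   \<Longrightarrow> path_dist \<Gamma> (edge_point \<Gamma> a s) (edge_point \<Gamma> a t) \<le> \<bar>s - t\<bar>"
  by (intro path_dist_le pl_path_edge)

lemma path_dist_self [simp]: "x \<in> realization \<Gamma> \<Longrightarrow> path_dist \<Gamma> x x = 0"
  using path_dist_le[OF pl_path.refl] path_dist_nonneg by (metis antisym)

text \<open>One interface for two kinds of graphs: the members of the family, with unit edges, and
  the quasi-tree, whose bridges have length \<open>K\<close>. The lower bound on edge lengths keeps
  distinct points at positive distance.\<close>

locale connected_metric_graph =
  fixes \<Gamma> :: "('v, 'e) metric_graph"
  assumes bidirected: "bidirected_digraph (digraph \<Gamma>) (reversal \<Gamma>)"
    and len_reversal: "a \<in> arcs (digraph \<Gamma>) \<Longrightarrow> len \<Gamma> (reversal \<Gamma> a) = len \<Gamma> a"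
    and len_ge_1: "a \<in> arcs (digraph \<Gamma>) \<Longrightarrow> 1 \<le> len \<Gamma> a"
    and joined: "\<lbrakk>x \<in> realization \<Gamma>; y \<in> realization \<Gamma>\<rbrakk> \<Longrightarrow> \<exists>l. pl_path \<Gamma> x y l"
begin

sublocale bidirected_digraph "digraph \<Gamma>" "reversal \<Gamma>"
  by (rule bidirected)

lemma edge_point_len [simp]:
  "a \<in> arcs (digraph \<Gamma>) \<Longrightarrow> edge_point \<Gamma> a (len \<Gamma> a) = Vertex (head (digraph \<Gamma>) a)"
  using len_ge_1[of a] by (simp add: edge_point_def)

lemma edge_point_interior:
  "\<lbrakk>0 < t; t < len \<Gamma> a\<rbrakk>
   \<Longrightarrow> edge_point \<Gamma> a t = Interior {(a, t), (reversal \<Gamma> a, len \<Gamma> a - t)}"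
  by (simp add: edge_point_def)

lemma edge_point_reversal:
  assumes "a \<in> arcs (digraph \<Gamma>)"
  shows "edge_point \<Gamma> (reversal \<Gamma> a) (len \<Gamma> a - t) = edge_point \<Gamma> a t"
  using assms len_ge_1[OF assms] len_reversal[OF assms]
  by (auto simp: edge_point_def insert_commute)

lemma realization_cases:
  assumes "x \<in> realization \<Gamma>"
  obtains (vertex) v where "v \<in> verts (digraph \<Gamma>)" "x = Vertex v"
  | (interior) a t where "a \<in> arcs (digraph \<Gamma>)" "0 < t" "t < len \<Gamma> a" "x = edge_point \<Gamma> a t"
proof -
  consider v where "v \<in> verts (digraph \<Gamma>)" "x = Vertex v"
    | a t where "a \<in> arcs (digraph \<Gamma>)" "0 \<le> t" "t \<le> len \<Gamma> a" "x = edge_point \<Gamma> a t"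
    using assms by (auto simp: realization_def)
  then show thesis
  proof cases
    case 2
    then consider "t = 0" | "t = len \<Gamma> a" | "0 < t \<and> t < len \<Gamma> a"
      by linarith
    then show thesis
    proof cases
      case 3
      with 2 that(2) show thesis
        by blast
    qed (use 2 that(1)[OF tail_in_verts] that(1)[OF head_in_verts] in auto)
  qed (rule that)
qed

lemma path_dist_greatest:
  assumes "x \<in> realization \<Gamma>" "y \<in> realization \<Gamma>" "\<And>l. pl_path \<Gamma> x y l \<Longrightarrow> c \<le> l"
  shows "c \<le> path_dist \<Gamma> x y"
proof -
  have "{l. pl_path \<Gamma> x y l} \<noteq> {}"
    using joined[OF assms(1,2)] by auto
  then show ?thesis
    using assms(3) by (auto simp: path_dist_def intro: cInf_greatest)
qed

lemma path_dist_triangle: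
  assumes x: "x \<in> realization \<Gamma>" and y: "y \<in> realization \<Gamma>" and z: "z \<in> realization \<Gamma>"
  shows "path_dist \<Gamma> x z \<le> path_dist \<Gamma> x y + path_dist \<Gamma> y z"
proof -
  have "path_dist \<Gamma> x z - path_dist \<Gamma> y z \<le> path_dist \<Gamma> x y"
  proof (rule path_dist_greatest[OF x y])
    fix l assume l: "pl_path \<Gamma> x y l"
    have "path_dist \<Gamma> x z - l \<le> path_dist \<Gamma> y z"
      using path_dist_le[OF pl_path_trans[OF l]] by (intro path_dist_greatest[OF y z]) force
    then show "path_dist \<Gamma> x z - path_dist \<Gamma> y z \<le> l"
      by simp
  qed
  then show ?thesis
    by simp
qed

lemma path_dist_triangle_abs:
  assumes "x \<in> realization \<Gamma>" "y \<in> realization \<Gamma>" "z \<in> realization \<Gamma>"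
  shows "\<bar>path_dist \<Gamma> x y - path_dist \<Gamma> x z\<bar> \<le> path_dist \<Gamma> y z"
  using path_dist_triangle[of x y z] path_dist_triangle[of x z y] assms
  by (simp add: path_dist_commute[of _ z y])

text \<open>The usual way below to bound a distance from below: what is 1-Lipschitz along each edge
  cannot vary along a path by more than its length.\<close>

lemma lipschitz_path_dist:
  fixes f :: "('v, 'e) point \<Rightarrow> real"
  assumes f: "\<And>a s t. \<lbrakk>a \<in> arcs (digraph \<Gamma>); s \<in> {0..len \<Gamma> a}; t \<in> {0..len \<Gamma> a}\<rbrakk>
                \<Longrightarrow> \<bar>f (edge_point \<Gamma> a s) - f (edge_point \<Gamma> a t)\<bar> \<le> \<bar>s - t\<bar>"
    and "x \<in> realization \<Gamma>" "y \<in> realization \<Gamma>"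
  shows "\<bar>f x - f y\<bar> \<le> path_dist \<Gamma> x y"
proof -
  have "\<bar>f x - f y\<bar> \<le> l" if "pl_path \<Gamma> x y l" for l
    using that
  proof (induction rule: pl_path.induct)
    case (step a s t y l)
    then show ?case
      using f[of a s t] by linarith
  qed simp
  then show ?thesis
    by (rule path_dist_greatest[OF assms(2,3)])
qed

text \<open>An interior point has two edge descriptions, so a function given in edge coordinates
  descends to the realization as soon as reversal preserves it. Its values at heads follow from
  those at tails of reversed arcs.\<close>

lemma edge_function:
  fixes H :: "'e \<Rightarrow> real \<Rightarrow> 'c" and g :: "'v \<Rightarrow> 'c"
  assumes H_rev: "\<And>a t. \<lbrakk>a \<in> arcs (digraph \<Gamma>); 0 \<le> t; t \<le> len \<Gamma> a\<rbrakk>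
                    \<Longrightarrow> H (reversal \<Gamma> a) (len \<Gamma> a - t) = H a t"
    and H_tail: "\<And>a. a \<in> arcs (digraph \<Gamma>) \<Longrightarrow> H a 0 = g (tail (digraph \<Gamma>) a)"
  obtains f where "\<And>v. f (Vertex v) = g v"
    and "\<And>a t. \<lbrakk>a \<in> arcs (digraph \<Gamma>); 0 \<le> t; t \<le> len \<Gamma> a\<rbrakk> \<Longrightarrow> f (edge_point \<Gamma> a t) = H a t"
proof -
  \<comment> \<open>Either description may be picked, since \<open>H_rev\<close> gives both the same
    value.\<close>
  define f where "f x = (case x of Vertex v \<Rightarrow> g v
    | Interior S \<Rightarrow> case_prod H (SOME b. b \<in> S))" for x :: "('v, 'e) point"
  have "f (edge_point \<Gamma> a t) = H a t" if a: "a \<in> arcs (digraph \<Gamma>)" "0 \<le> t" "t \<le> len \<Gamma> a" for a t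
  proof -
    consider "t = 0" | "t = len \<Gamma> a" | "0 < t" "t < len \<Gamma> a"
      using a by linarith
    then show ?thesis
    proof cases
      case 2
      then show ?thesis
        using a H_rev[OF a] H_tail[of "reversal \<Gamma> a"] by (simp add: f_def)
    next
      case 3
      define S where "S = {(a, t), (reversal \<Gamma> a, len \<Gamma> a - t)}"
      have "(SOME b. b \<in> S) \<in> S"
        by (rule someI[of _ "(a, t)"]) (simp add: S_def)
      then have "case_prod H (SOME b. b \<in> S) = H a t"
        using H_rev[OF a] by (cases "SOME b. b \<in> S") (simp add: S_def, blast)
      then show ?thesis
        using 3 by (simp add: edge_point_interior f_def S_def)
    qed (simp add: f_def H_tail a)
  qed
  then show thesis
    using that[of f] by (simp add: f_def)
qed

lemma lipschitz_edge_function: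
  fixes H :: "'e \<Rightarrow> real \<Rightarrow> real" and g :: "'v \<Rightarrow> real"
  assumes H_rev: "\<And>a t. \<lbrakk>a \<in> arcs (digraph \<Gamma>); 0 \<le> t; t \<le> len \<Gamma> a\<rbrakk>
                    \<Longrightarrow> H (reversal \<Gamma> a) (len \<Gamma> a - t) = H a t"
    and H_tail: "\<And>a. a \<in> arcs (digraph \<Gamma>) \<Longrightarrow> H a 0 = g (tail (digraph \<Gamma>) a)"
    and H_lip: "\<And>a s t. \<lbrakk>a \<in> arcs (digraph \<Gamma>); s \<in> {0..len \<Gamma> a}; t \<in> {0..len \<Gamma> a}\<rbrakk>
                  \<Longrightarrow> \<bar>H a s - H a t\<bar> \<le> \<bar>s - t\<bar>"
  shows "\<exists>f. (\<forall>v. f (Vertex v) = g v)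
    \<and> (\<forall>a\<in>arcs (digraph \<Gamma>). \<forall>t\<in>{0..len \<Gamma> a}. f (edge_point \<Gamma> a t) = H a t)
    \<and> (\<forall>x\<in>realization \<Gamma>. \<forall>y\<in>realization \<Gamma>. \<bar>f x - f y\<bar> \<le> path_dist \<Gamma> x y)"
proof -
  obtain f where f: "\<And>v. f (Vertex v) = g v"
    "\<And>a t. \<lbrakk>a \<in> arcs (digraph \<Gamma>); 0 \<le> t; t \<le> len \<Gamma> a\<rbrakk> \<Longrightarrow> f (edge_point \<Gamma> a t) = H a t"
    using edge_function[of H g] H_rev H_tail by metis
  have "\<bar>f (edge_point \<Gamma> a s) - f (edge_point \<Gamma> a t)\<bar> \<le> \<bar>s - t\<bar>"
    if "a \<in> arcs (digraph \<Gamma>)" "s \<in> {0..len \<Gamma> a}" "t \<in> {0..len \<Gamma> a}" for a s t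
    using f(2) H_lip that by simp
  then have "\<bar>f x - f y\<bar> \<le> path_dist \<Gamma> x y" if "x \<in> realization \<Gamma>" "y \<in> realization \<Gamma>" for x y
    by (rule lipschitz_path_dist[OF _ that])
  with f show ?thesis
    by (intro exI[of _ f]) simp
qed

text \<open>A separating function does the work: a truncated distance from \<open>x\<close>,
  computed only on the edges around \<open>x\<close> and constant elsewhere, is 1-Lipschitz and
  vanishes only at \<open>x\<close>.\<close>

lemma path_dist_eq_0:
  assumes x: "x \<in> realization \<Gamma>" and y: "y \<in> realization \<Gamma>" and 0: "path_dist \<Gamma> x y = 0"
  shows "x = y"
proof -
  let ?A = "arcs (digraph \<Gamma>)"
  \<comment> \<open>The minimum over both orientations makes a function of edge coordinates
    reversal-invariant and keeps it 1-Lipschitz.\<close>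
  define sym where "sym h a t = min (h a t) (h (reversal \<Gamma> a) (len \<Gamma> a - t))"
    for h :: "'e \<Rightarrow> real \<Rightarrow> real" and a t
  have sym_rev: "sym h (reversal \<Gamma> a) (len \<Gamma> a - t) = sym h a t" if "a \<in> ?A" for h a t
    using that by (simp add: sym_def len_reversal min.commute)
  have sym_lip: "\<bar>sym h a s - sym h a t\<bar> \<le> \<bar>s - t\<bar>"
    if "\<And>a s t. \<bar>h a s - h a t\<bar> \<le> \<bar>s - t\<bar>" for h a s t
  proof -
    have "\<bar>h a s - h a t\<bar> \<le> \<bar>s - t\<bar>"
      "\<bar>h (reversal \<Gamma> a) (len \<Gamma> a - s) - h (reversal \<Gamma> a) (len \<Gamma> a - t)\<bar> \<le> \<bar>s - t\<bar>"
      using that[of a s t] that[of "reversal \<Gamma> a" "len \<Gamma> a - s" "len \<Gamma> a - t"] by auto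
    then show ?thesis
      by (auto simp: sym_def min_def)
  qed
  from x show ?thesis
  proof (cases rule: realization_cases)
    case (vertex v)
    \<comment> \<open>Truncation at 1 fits because edges have length at least 1: the coordinate from
      \<open>v\<close> has reached the cutoff at the other end of the edge.\<close>
    define h :: "'e \<Rightarrow> real \<Rightarrow> real" where "h a t = (if tail (digraph \<Gamma>) a = v then min 1 \<bar>t\<bar> else 1)" for a t
    have h_lip: "\<bar>h a s - h a t\<bar> \<le> \<bar>s - t\<bar>" for a s t
      by (auto simp: h_def)
    have tail: "sym h a 0 = (if tail (digraph \<Gamma>) a = v then 0 else 1)" if "a \<in> ?A" for a
      using that len_ge_1[OF that] by (auto simp: h_def sym_def)
    have "\<exists>f. (\<forall>w. f (Vertex w) = (if w = v then 0 else 1))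
      \<and> (\<forall>a\<in>?A. \<forall>t\<in>{0..len \<Gamma> a}. f (edge_point \<Gamma> a t) = sym h a t)
      \<and> (\<forall>x\<in>realization \<Gamma>. \<forall>y\<in>realization \<Gamma>. \<bar>f x - f y\<bar> \<le> path_dist \<Gamma> x y)"
      by (rule lipschitz_edge_function) (simp_all add: sym_rev tail sym_lip h_lip)
    then obtain f where "\<forall>w. f (Vertex w) = (if w = v then 0 else 1)"
      "\<forall>a\<in>?A. \<forall>t\<in>{0..len \<Gamma> a}. f (edge_point \<Gamma> a t) = sym h a t"
      "\<forall>x\<in>realization \<Gamma>. \<forall>y\<in>realization \<Gamma>. \<bar>f x - f y\<bar> \<le> path_dist \<Gamma> x y"
      by blast
    note f = this[rule_format]
    have fy: "f y = 0"
      using f(1)[of v] f(3)[OF x y] 0 vertex by simp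
    from y show ?thesis
    proof (cases rule: realization_cases)
      case vertex
      then show ?thesis
        using fy f(1) \<open>x = Vertex v\<close> by (auto split: if_splits)
    next
      case (interior a t)
      then show ?thesis
        using fy f(2)[of a t] by (auto simp: sym_def h_def min_def split: if_splits)
    qed
  next
    case (interior b u)
    \<comment> \<open>With \<open>r\<close> the distance to the nearer end of \<open>b\<close>, the
      truncated distance to \<open>x\<close> equals \<open>r\<close> at both ends of
      \<open>b\<close> and extends by the constant \<open>r\<close>.\<close>
    define r where "r = min u (len \<Gamma> b - u)"
    define h :: "'e \<Rightarrow> real \<Rightarrow> real" where "h a t = (if a = b then min r \<bar>t - u\<bar> else r)" for a t
    have r: "0 < r" "r \<le> u" "r \<le> len \<Gamma> b - u"
      using interior by (auto simp: r_def)
    have h_lip: "\<bar>h a s - h a t\<bar> \<le> \<bar>s - t\<bar>" for a s t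
      by (auto simp: h_def)
    have h_at: "sym h b u = 0"
      using r by (auto simp: sym_def h_def)
    have tail: "sym h a 0 = r" if "a \<in> ?A" for a
    proof -
      have "h a 0 = r"
        using r by (auto simp: h_def)
      moreover have "h (reversal \<Gamma> a) (len \<Gamma> a) = r"
        using r len_reversal[OF that] by (auto simp: h_def)
      ultimately show ?thesis
        by (simp add: sym_def)
    qed
    have "\<exists>f. (\<forall>w. f (Vertex w) = (r))
      \<and> (\<forall>a\<in>?A. \<forall>t\<in>{0..len \<Gamma> a}. f (edge_point \<Gamma> a t) = sym h a t)
      \<and> (\<forall>x\<in>realization \<Gamma>. \<forall>y\<in>realization \<Gamma>. \<bar>f x - f y\<bar> \<le> path_dist \<Gamma> x y)"
      by (rule lipschitz_edge_function) (simp_all add: sym_rev tail sym_lip h_lip)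
    then obtain f where "\<forall>w. f (Vertex w) = (r)"
      "\<forall>a\<in>?A. \<forall>t\<in>{0..len \<Gamma> a}. f (edge_point \<Gamma> a t) = sym h a t"
      "\<forall>x\<in>realization \<Gamma>. \<forall>y\<in>realization \<Gamma>. \<bar>f x - f y\<bar> \<le> path_dist \<Gamma> x y"
      by blast
    note f = this[rule_format]
    have "f x = 0"
      using f(2)[of b u] interior h_at by simp
    then have fy: "f y = 0"
      using f(3)[OF x y] 0 by simp
    from y show ?thesis
    proof (cases rule: realization_cases)
      case vertex
      then show ?thesis
        using fy f(1) r by simp
    next
      case a: (interior a t)
      then have "h a t = 0 \<or> h (reversal \<Gamma> a) (len \<Gamma> a - t) = 0"
        using fy f(2)[of a t] by (auto simp: sym_def min_def split: if_splits)
      then have "a = b \<and> t = u \<or> reversal \<Gamma> a = b \<and> len \<Gamma> a - t = u"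
        using r by (auto simp: h_def min_def split: if_splits)
      then show ?thesis
        using a interior edge_point_reversal[of a t] by auto
    qed
  qed
qed

lemma Metric_space_path_dist: "Metric_space (realization \<Gamma>) (path_dist \<Gamma>)"
proof
  show "path_dist \<Gamma> x y = path_dist \<Gamma> y x" for x y
    by (rule path_dist_commute)
  show "path_dist \<Gamma> x y = 0 \<longleftrightarrow> x = y" if "x \<in> realization \<Gamma>" "y \<in> realization \<Gamma>" for x y
    using that path_dist_eq_0 by auto
qed (simp_all add: path_dist_triangle)

end

lemma connected_unit_graph_connected_metric_graph:
  assumes "connected_unit_graph \<Gamma>"
  shows "connected_metric_graph \<Gamma>"
proof -
  interpret bidirected_digraph "digraph \<Gamma>" "reversal \<Gamma>"
    using assms by (simp add: connected_unit_graph_def)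
  have len: "len \<Gamma> a = 1" if "a \<in> arcs (digraph \<Gamma>)" for a
    using assms that by (simp add: connected_unit_graph_def)
  have edge: "\<exists>l. pl_path \<Gamma> (Vertex (tail (digraph \<Gamma>) a)) (Vertex (head (digraph \<Gamma>) a)) l"
    if "a \<in> arcs (digraph \<Gamma>)" for a
    using pl_path_edge[of a \<Gamma> 0 1] len[OF that] that by (auto simp: edge_point_def)
  have vertices: "\<exists>l. pl_path \<Gamma> (Vertex v) (Vertex w) l"
    if "v \<in> verts (digraph \<Gamma>)" "w \<in> verts (digraph \<Gamma>)" for v w
  proof -
    have "(v, w) \<in> rtrancl_on (verts (digraph \<Gamma>)) ((arcs_ends (digraph \<Gamma>))\<^sup>s)"
      using assms that by (simp add: connected_unit_graph_def connected_conv)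
    then show ?thesis
    proof (induction rule: rtrancl_on_induct)
      case base
      then show ?case
        by (blast intro: pl_path.refl vertex_in_realization)
    next
      case (step w w')
      then obtain a where a: "a \<in> arcs (digraph \<Gamma>)"
        "w = tail (digraph \<Gamma>) a \<and> w' = head (digraph \<Gamma>) a \<or>
         w = head (digraph \<Gamma>) a \<and> w' = tail (digraph \<Gamma>) a"
        by (auto simp: symcl_def arcs_ends_conv)
      then have "\<exists>l. pl_path \<Gamma> (Vertex w) (Vertex w') l"
        using edge[OF a(1)] pl_path_sym by blast
      then show ?case
        using step.IH pl_path_trans by blast
    qed
  qed
  have to_vertex: "\<exists>v\<in>verts (digraph \<Gamma>). \<exists>l. pl_path \<Gamma> x (Vertex v) l" if "x \<in> realization \<Gamma>" for x
    using that unfolding realization_def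
  proof (elim UnE CollectE exE conjE)
    assume "x \<in> Vertex ` verts (digraph \<Gamma>)"
    then show ?thesis
      by (blast intro: pl_path.refl vertex_in_realization)
  next
    fix a t assume a: "x = edge_point \<Gamma> a t" "a \<in> arcs (digraph \<Gamma>)" "0 \<le> t" "t \<le> len \<Gamma> a"
    then show ?thesis
      using pl_path_edge[of a \<Gamma> t 0] by (auto intro!: bexI[of _ "tail (digraph \<Gamma>) a"])
  qed
  have "\<exists>l. pl_path \<Gamma> x y l" if x: "x \<in> realization \<Gamma>" and y: "y \<in> realization \<Gamma>" for x y
  proof -
    obtain v l where "v \<in> verts (digraph \<Gamma>)" "pl_path \<Gamma> x (Vertex v) l"
      using to_vertex[OF x] by blast
    moreover obtain w m where "w \<in> verts (digraph \<Gamma>)" "pl_path \<Gamma> y (Vertex w) m"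
      using to_vertex[OF y] by blast
    ultimately show ?thesis
      using vertices[of v w] by (blast intro: pl_path_trans pl_path_sym)
  qed
  then show ?thesis
    by (intro connected_metric_graph.intro bidirected_digraph) (simp_all add: len)
qed

section \<open>Combinatorics of the projections\<close>

lemma diam_le_iff: "diam d S \<le> c \<longleftrightarrow> (\<forall>x\<in>S. \<forall>y\<in>S. ennreal (d x y) \<le> c)"
  by (simp add: diam_def SUP_le_iff)

lemma diam_upper: "\<lbrakk>x \<in> S; y \<in> S\<rbrakk> \<Longrightarrow> ennreal (d x y) \<le> diam d S"
  using diam_le_iff[of d S "diam d S"] by blast

lemma card_inj_nat_less:
  assumes "inj_on f A" "\<forall>a\<in>A. f a < (n::nat)"
  shows "finite A" "card A \<le> n"
proof -
  have image: "f ` A \<subseteq> {..<n}"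
    using assms(2) by auto
  show "finite A"
    using assms(1) image by (rule inj_on_finite) simp
  show "card A \<le> n"
    using card_inj_on_le[OF assms(1) image] by simp
qed

locale quasi_tree_of_spaces = projection_family \<Y> \<theta>
  for \<Y> :: "('i, 'v, 'e) graph_family" and \<theta> :: nat +
  fixes K :: nat
  assumes K_pos: "K > 0" and K_large: "K \<ge> 4 * \<theta>"
begin

abbreviation "\<M> \<equiv> members \<Y>"

lemma member_graph: "Y \<in> \<M> \<Longrightarrow> connected_metric_graph (graph \<Y> Y)"
  by (intro connected_unit_graph_connected_metric_graph graphs)

lemma theta_less: "of_nat K < c \<Longrightarrow> of_nat \<theta> < (c :: ennreal)"
  using K_large by (elim le_less_trans[rotated]) simp

text \<open>Splitting a distance above \<open>K\<close> by the triangle inequality leaves a part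
  above \<theta>, to which (P1') applies. This rests on two copies of \<theta> fitting into
  \<open>K\<close>.\<close>

lemma large_summand:
  fixes a b :: ennreal
  assumes "of_nat K < a + b"
  shows "of_nat \<theta> < a \<or> of_nat \<theta> < b"
proof (rule ccontr)
  assume "\<not> ?thesis"
  then have "a + b \<le> of_nat \<theta> + of_nat \<theta>"
    by (intro add_mono) auto
  also have "\<dots> = of_nat (\<theta> + \<theta>)"
    by simp
  also have "\<dots> \<le> (of_nat K :: ennreal)"
    using K_large by (intro of_nat_mono) simp
  finally show False
    using assms by simp
qed

section \<open>Projections and projection distances for points of the disjoint union\<close>

definition point_proj :: "'i \<Rightarrow> 'i \<times> ('v, 'e) point \<Rightarrow> ('v, 'e) point set" where
  "point_proj U x = (if fst x = U then {snd x} else Vertex ` proj \<Y> U (fst x))"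

definition pdist :: "'i \<Rightarrow> 'i \<times> ('v, 'e) point \<Rightarrow> 'i \<times> ('v, 'e) point \<Rightarrow> ennreal" where
  "pdist U x z = diam (path_dist (graph \<Y> U)) (point_proj U x \<union> point_proj U z)"

lemma disjoint_union_iff: "x \<in> disjoint_union \<Y> \<longleftrightarrow> fst x \<in> \<M> \<and> snd x \<in> realization (graph \<Y> (fst x))"
  by (cases x) (auto simp: disjoint_union_def)

lemma pdist_eq_proj_dist:
  "\<lbrakk>fst x \<noteq> U; fst z \<noteq> U\<rbrakk> \<Longrightarrow> pdist U x z = proj_dist \<Y> U (fst x) (fst z)"
  by (simp add: pdist_def point_proj_def proj_dist_def image_Un)

lemma point_proj_subset:
  "\<lbrakk>U \<in> \<M>; x \<in> disjoint_union \<Y>\<rbrakk> \<Longrightarrow> point_proj U x \<subseteq> realization (graph \<Y> U)"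
  using proj_vertices[of "fst x" U]
  by (auto simp: point_proj_def disjoint_union_iff intro!: vertex_in_realization)

lemma point_proj_nonempty: "\<lbrakk>U \<in> \<M>; x \<in> disjoint_union \<Y>\<rbrakk> \<Longrightarrow> point_proj U x \<noteq> {}"
  using proj_nonempty[of "fst x" U] by (auto simp: point_proj_def disjoint_union_iff)

lemma pdist_commute: "pdist U x z = pdist U z x"
  by (simp add: pdist_def Un_commute)

lemma pdist_upper:
  "\<lbrakk>p \<in> point_proj U x; q \<in> point_proj U z\<rbrakk> \<Longrightarrow> ennreal (path_dist (graph \<Y> U) p q) \<le> pdist U x z"
  unfolding pdist_def by (rule diam_upper) auto

lemma pdist_self:
  assumes "U \<in> \<M>" "x \<in> disjoint_union \<Y>"
  shows "pdist U x x \<le> of_nat \<theta>"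
proof (cases "fst x = U")
  case True
  then show ?thesis
    using assms by (simp add: pdist_def point_proj_def diam_le_iff disjoint_union_iff)
next
  case False
  then show ?thesis
    using assms proj_diam[of "fst x" U] by (simp add: pdist_eq_proj_dist disjoint_union_iff)
qed

lemma pdist_self_le: "pdist U x x \<le> pdist U x z"
  unfolding pdist_def diam_le_iff[of _ "_ \<union> point_proj U x"] by (intro ballI diam_upper) blast+

lemma pdist_triangle:
  assumes U: "U \<in> \<M>" and x: "x \<in> disjoint_union \<Y>" and y: "y \<in> disjoint_union \<Y>"
    and z: "z \<in> disjoint_union \<Y>"
  shows "pdist U x z \<le> pdist U x y + pdist U y z"
proof -
  interpret connected_metric_graph "graph \<Y> U"
    using U by (rule member_graph)
  let ?d = "path_dist (graph \<Y> U)"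
  obtain q where q: "q \<in> point_proj U y"
    using point_proj_nonempty[OF U y] by blast
  have cross: "ennreal (?d p r) \<le> pdist U x y + pdist U y z"
    if "p \<in> point_proj U x" "r \<in> point_proj U z" for p r
  proof -
    have "?d p r \<le> ?d p q + ?d q r"
      using that q point_proj_subset[OF U] x y z by (blast intro: path_dist_triangle)
    then have "ennreal (?d p r) \<le> ennreal (?d p q) + ennreal (?d q r)"
      by (simp flip: ennreal_plus add: ennreal_leI)
    also have "\<dots> \<le> pdist U x y + pdist U y z"
      using that q by (intro add_mono pdist_upper)
    finally show ?thesis .
  qed
  \<comment> \<open>A pair inside a single projection does not pass through \<open>q\<close>: its
    distance is already bounded by one of the two summands.\<close>
  have "ennreal (?d p r) \<le> pdist U x y + pdist U y z"
    if "p \<in> point_proj U x" "r \<in> point_proj U x" for p r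
    using pdist_upper[OF that] pdist_self_le[of U x y] by (meson add_increasing2 order_trans zero_le)
  moreover have "ennreal (?d p r) \<le> pdist U x y + pdist U y z"
    if "p \<in> point_proj U z" "r \<in> point_proj U z" for p r
    using pdist_upper[OF that] pdist_self_le[of U z y]
    by (metis add_increasing order_trans pdist_commute zero_le)
  ultimately show ?thesis
    unfolding pdist_def[of U x z] diam_le_iff
    using cross path_dist_commute[of "graph \<Y> U"] by (metis Un_iff)
qed

lemma proj_dist_commute: "proj_dist \<Y> U X Z = proj_dist \<Y> U Z X"
  by (simp add: proj_dist_def Un_commute)

lemma obtain_point:
  assumes "X \<in> \<M>"
  obtains p where "(X, p) \<in> disjoint_union \<Y>"
proof -
  have "verts (digraph (graph \<Y> X)) \<noteq> {}"
    using graphs[OF assms] by (simp add: connected_unit_graph_def connected_conv)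
  then show thesis
    using that assms vertex_in_realization by (fastforce simp: disjoint_union_def)
qed

lemma proj_dist_triangle:
  assumes "U \<in> \<M>" "X \<in> \<M>" "Y \<in> \<M>" "Z \<in> \<M>" "X \<noteq> U" "Y \<noteq> U" "Z \<noteq> U"
  shows "proj_dist \<Y> U X Z \<le> proj_dist \<Y> U X Y + proj_dist \<Y> U Y Z"
proof -
  obtain p q r where "(X, p) \<in> disjoint_union \<Y>" "(Y, q) \<in> disjoint_union \<Y>"
    "(Z, r) \<in> disjoint_union \<Y>"
    using assms obtain_point by metis
  then show ?thesis
    using pdist_triangle[of U "(X, p)" "(Y, q)" "(Z, r)"] assms by (simp add: pdist_eq_proj_dist)
qed

lemma proj_dist_cong: "proj \<Y> U X = proj \<Y> U X' \<Longrightarrow> proj_dist \<Y> U X Z = proj_dist \<Y> U X' Z"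
  by (simp add: proj_dist_def)

text \<open>(P1') asks for pairwise distinct members; here \<open>X = Z\<close> is excluded because
  \<open>proj_diam\<close> would bound the distance by \<theta>.\<close>

lemma proj_eq_of_large:
  assumes "X \<in> \<M>" "Y \<in> \<M>" "Z \<in> \<M>" "X \<noteq> Y" "Z \<noteq> Y" "of_nat \<theta> < proj_dist \<Y> Y X Z"
  shows "proj \<Y> X Y = proj \<Y> X Z" "X \<noteq> Z"
proof -
  show "X \<noteq> Z"
    using assms proj_diam[of X Y] by auto
  then show "proj \<Y> X Y = proj \<Y> X Z"
    using assms P1'[of X Y Z] by auto
qed

text \<open>(P1') for points. When \<open>z\<close> itself lies in \<open>V\<close>, the two
  projections to \<open>U\<close> are the same set by definition. The points \<open>u\<close> and
  \<open>v\<close> merely name their members.\<close>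

lemma point_proj_eq_of_large:
  assumes U: "U \<in> \<M>" and "V \<in> \<M>" "U \<noteq> V" and z: "z \<in> disjoint_union \<Y>"
    and u: "fst u = U" and v: "fst v = V" and large: "of_nat \<theta> < pdist V u z"
  shows "point_proj U z = point_proj U v"
proof (cases "fst z = V")
  case True
  then show ?thesis
    using assms by (simp add: point_proj_def)
next
  case False
  then have "of_nat \<theta> < proj_dist \<Y> V U (fst z)"
    using large assms by (simp add: pdist_eq_proj_dist)
  then show ?thesis
    using proj_eq_of_large[of U V "fst z"] assms False by (simp add: point_proj_def disjoint_union_iff)
qed

lemma pdist_cong: "point_proj U x = point_proj U x' \<Longrightarrow> pdist U x z = pdist U x' z"
  by (simp add: pdist_def)

text \<open>The open interval between \<open>X\<close> and \<open>Z\<close> at threshold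
  \<open>K\<close>; for distinct members, its emptiness is adjacency in the projection
  complex.\<close>

definition separators :: "'i \<Rightarrow> 'i \<Rightarrow> 'i set" where
  "separators X Z = {U \<in> \<M> - {X, Z}. of_nat K < proj_dist \<Y> U X Z}"

lemma separators_commute: "separators X Z = separators Z X"
  by (auto simp: separators_def proj_dist_commute)

lemma adjacent_iff:
  "proj_complex_adj \<Y> K X Z \<longleftrightarrow> X \<in> \<M> \<and> Z \<in> \<M> \<and> X \<noteq> Z \<and> separators X Z = {}"
  by (auto simp: proj_complex_adj_def separators_def not_less)

lemma proj_complex_adj_commute: "proj_complex_adj \<Y> K X Z = proj_complex_adj \<Y> K Z X"
  by (auto simp: adjacent_iff separators_commute)

lemma finite_separators: "\<lbrakk>X \<in> \<M>; Z \<in> \<M>\<rbrakk> \<Longrightarrow> finite (separators X Z)"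
  by (rule finite_subset[OF _ finite_large[of X Z]]) (auto simp: separators_def intro: theta_less)

lemma separatorsD:
  assumes "V \<in> separators X Z" "X \<in> \<M>" "Z \<in> \<M>"
  shows "V \<in> \<M>" "V \<noteq> X" "V \<noteq> Z" "X \<noteq> Z" "of_nat K < proj_dist \<Y> V X Z"
    "of_nat \<theta> < proj_dist \<Y> V X Z" "proj \<Y> X V = proj \<Y> X Z" "proj \<Y> Z V = proj \<Y> Z X"
proof -
  show V: "V \<in> \<M>" "V \<noteq> X" "V \<noteq> Z" and K: "of_nat K < proj_dist \<Y> V X Z"
    using assms by (auto simp: separators_def)
  from K show large: "of_nat \<theta> < proj_dist \<Y> V X Z"
    by (rule theta_less)
  show "X \<noteq> Z" "proj \<Y> X V = proj \<Y> X Z"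
    using proj_eq_of_large[of X V Z] assms V large by auto
  show "proj \<Y> Z V = proj \<Y> Z X"
    using proj_eq_of_large[of Z V X] assms V large by (auto simp: proj_dist_commute)
qed

text \<open>Initial segments are nested. If \<open>W\<close> separates \<open>X\<close> from
  \<open>V\<close>, then \<open>V\<close> sees \<open>W\<close> where it sees \<open>X\<close>, far
  from \<open>Z\<close>; by (P1') \<open>W\<close> sees \<open>V\<close> where it sees
  \<open>Z\<close>. Hence the distances at \<open>W\<close> from \<open>X\<close> to
  \<open>V\<close> and from \<open>X\<close> to \<open>Z\<close> agree exactly.\<close>

lemma separators_subset:
  assumes V: "V \<in> separators X Z" and X: "X \<in> \<M>" and Z: "Z \<in> \<M>"
  shows "separators X V \<subseteq> separators X Z - {V}"
proof
  fix W assume W: "W \<in> separators X V"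
  note V' = separatorsD[OF V X Z]
  note W' = separatorsD[OF W X V'(1)]
  have "proj_dist \<Y> Z X V \<le> of_nat \<theta>"
    using proj_dist_cong[OF V'(8), of X] proj_diam[of X Z] V' X Z by (simp add: proj_dist_commute)
  then have WZ: "W \<noteq> Z"
    using W'(6) by auto
  have "proj_dist \<Y> V W Z = proj_dist \<Y> V X Z"
    using W'(8) by (intro proj_dist_cong)
  then have "proj \<Y> W V = proj \<Y> W Z"
    using proj_eq_of_large(1)[of W V Z] V' W' Z by auto
  then have "proj_dist \<Y> W X Z = proj_dist \<Y> W X V"
    by (metis proj_dist_commute proj_dist_cong)
  then show "W \<in> separators X Z - {V}"
    using W' WZ by (auto simp: separators_def)
qed

lemma card_separators_less:
  assumes "V \<in> separators X Z" "X \<in> \<M>" "Z \<in> \<M>"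
  shows "card (separators X V) < card (separators X Z)"
proof -
  have "separators X V \<subset> separators X Z"
    using separators_subset[OF assms] assms(1) by blast
  then show ?thesis
    by (intro psubset_card_mono finite_separators assms)
qed

text \<open>The triangle inequality at \<open>U\<close> through \<open>V\<close> leaves a distance
  above \<theta>. (P1') turns this into an exact equality: the distance from \<open>X\<close> to the
  other element, measured at \<open>U\<close> or at \<open>V\<close>, is the one from
  \<open>X\<close> to \<open>Z\<close>, hence above \<open>K\<close> again.\<close>

lemma separators_linear:
  assumes U: "U \<in> separators X Z" and V: "V \<in> separators X Z" and "U \<noteq> V"
    and X: "X \<in> \<M>" and Z: "Z \<in> \<M>"
  shows "U \<in> separators X V \<or> V \<in> separators X U"
proof -
  note U' = separatorsD[OF U X Z] and V' = separatorsD[OF V X Z]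
  have "of_nat K < proj_dist \<Y> U X V + proj_dist \<Y> U V Z"
    using proj_dist_triangle[of U X V Z] U' V' X Z \<open>U \<noteq> V\<close> by auto
  then consider "of_nat \<theta> < proj_dist \<Y> U X V" | "of_nat \<theta> < proj_dist \<Y> U V Z"
    using large_summand by blast
  then show ?thesis
  proof cases
    case 1
    then have "proj \<Y> V U = proj \<Y> V X"
      using proj_eq_of_large(1)[of V U X] U' V' X \<open>U \<noteq> V\<close> by (simp add: proj_dist_commute)
    then have "proj_dist \<Y> V U Z = proj_dist \<Y> V X Z"
      by (rule proj_dist_cong)
    then have "proj \<Y> U V = proj \<Y> U Z"
      using proj_eq_of_large(1)[of U V Z] U' V' Z \<open>U \<noteq> V\<close> by simp
    then have "proj_dist \<Y> U X V = proj_dist \<Y> U X Z"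
      by (metis proj_dist_commute proj_dist_cong)
    then show ?thesis
      using U' \<open>U \<noteq> V\<close> by (auto simp: separators_def)
  next
    case 2
    then have "proj \<Y> V U = proj \<Y> V Z"
      using proj_eq_of_large(1)[of V U Z] U' V' Z \<open>U \<noteq> V\<close> by simp
    then have "proj_dist \<Y> V X U = proj_dist \<Y> V X Z"
      by (metis proj_dist_commute proj_dist_cong)
    then show ?thesis
      using V' \<open>U \<noteq> V\<close> by (auto simp: separators_def)
  qed
qed

text \<open>Of two separators, one lies between \<open>X\<close> and the other and then has strictly
  smaller position.\<close>

lemma inj_on_card_separators:
  assumes "X \<in> \<M>" "Z \<in> \<M>"
  shows "inj_on (\<lambda>V. card (separators X V)) (separators X Z)"
proof (rule inj_onI, rule ccontr)
  fix U V assume UV: "U \<in> separators X Z" "V \<in> separators X Z"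
    "card (separators X U) = card (separators X V)" "U \<noteq> V"
  then have "U \<in> separators X V \<or> V \<in> separators X U"
    using separators_linear assms by blast
  then show False
    using card_separators_less[of U X V] card_separators_less[of V X U] UV assms by (auto dest: separatorsD(1))
qed

text \<open>
  If \<open>X\<close> and \<open>X'\<close> projected differently to \<open>W\<close>, the two elements \<open>V1 < V2\<close> separating \<open>X\<close> from \<open>W\<close>
  would both be far from \<open>X'\<close>, so that \<open>V1\<close> would separate \<open>X\<close> from \<open>X'\<close>.
\<close>

lemma adjacent_proj_eq:
  assumes adj: "proj_complex_adj \<Y> K X X'" and W: "W \<in> separators X Z" and Z: "Z \<in> \<M>"
    and two: "2 \<le> card (separators X W)"
  shows "X' \<noteq> W" "proj \<Y> W X' = proj \<Y> W X"
proof -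
  have X: "X \<in> \<M>" "X' \<in> \<M>" "X \<noteq> X'" and empty: "separators X X' = {}"
    using adj by (auto simp: adjacent_iff)
  note W' = separatorsD[OF W X(1) Z]
  obtain A B where "A \<in> separators X W" "B \<in> separators X W" "A \<noteq> B"
    using two card_le_Suc0_iff_eq[OF finite_separators[OF X(1) W'(1)]] by fastforce
  then obtain V1 V2 where V1: "V1 \<in> separators X W" and V2: "V2 \<in> separators X W"
    and V12: "V1 \<in> separators X V2"
    using separators_linear X W' by blast
  note V1' = separatorsD[OF V1 X(1) W'(1)] and V2' = separatorsD[OF V2 X(1) W'(1)]
  note V12' = separatorsD[OF V12 X(1) V2'(1)]
  show XW: "X' \<noteq> W"
    using V2 empty by auto
  have XV2: "X' \<noteq> V2"
    using V12 empty by auto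
  show "proj \<Y> W X' = proj \<Y> W X"
  proof (cases "X' = V1")
    case True
    then show ?thesis
      using V1'(8) by simp
  next
    case False
    have "of_nat \<theta> < proj_dist \<Y> V2 X' W"
    proof (rule ccontr)
      assume small: "\<not> ?thesis"
      have "proj_dist \<Y> V2 X W \<le> proj_dist \<Y> V2 X X' + proj_dist \<Y> V2 X' W"
        by (rule proj_dist_triangle) (use X W' V2' XV2 in auto)
      then have "of_nat \<theta> < proj_dist \<Y> V2 X X'"
        using V2'(5) large_summand small by (meson order_less_le_trans)
      moreover have "proj_dist \<Y> V2 V1 X' = proj_dist \<Y> V2 X X'"
        using V12'(8) by (rule proj_dist_cong)
      ultimately have "proj \<Y> V1 V2 = proj \<Y> V1 X'"
        using proj_eq_of_large(1)[of V1 V2 X'] V1' V2' V12' X XV2 by simp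
      then have "proj_dist \<Y> V1 X X' = proj_dist \<Y> V1 X V2"
        by (metis proj_dist_commute proj_dist_cong)
      then have "V1 \<in> separators X X'"
        using V12' False by (auto simp: separators_def)
      then show False
        using empty by simp
    qed
    then have "proj \<Y> W V2 = proj \<Y> W X'"
      using proj_eq_of_large(1)[of W V2 X'] W' V2' X XV2 by (simp add: proj_dist_commute)
    then show ?thesis
      using V2'(8) by simp
  qed
qed

lemma separators_adjacent:
  assumes adj: "proj_complex_adj \<Y> K X X'" and W: "W \<in> separators X Z" and Z: "Z \<in> \<M>"
    and two: "2 \<le> card (separators X W)"
  shows "W \<in> separators X' Z"
proof -
  have X: "X \<in> \<M>"
    using adj by (simp add: adjacent_iff)
  have "proj_dist \<Y> W X' Z = proj_dist \<Y> W X Z"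
    by (intro proj_dist_cong adjacent_proj_eq[OF assms])
  then show ?thesis
    using separatorsD[OF W X Z] adjacent_proj_eq(1)[OF assms] by (auto simp: separators_def)
qed

text \<open>Passing to \<open>X'\<close> can only lose separators at position 0 or 1, and positions
  are distinct, so at most two are lost.\<close>

lemma card_separators_adjacent:
  assumes adj: "proj_complex_adj \<Y> K X X'" and U: "U \<in> \<M>"
  shows "card (separators X U) \<le> card (separators X' U) + 2"
proof -
  have X: "X \<in> \<M>" "X' \<in> \<M>"
    using adj by (auto simp: adjacent_iff)
  define S where "S = {W \<in> separators X U. card (separators X W) < 2}"
  have "inj_on (\<lambda>V. card (separators X V)) S"
    using inj_on_card_separators[OF X(1) U] by (rule inj_on_subset) (auto simp: S_def)
  moreover have "\<forall>V\<in>S. card (separators X V) < 2"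
    by (simp add: S_def)
  ultimately have S: "finite S" "card S \<le> 2"
    by (rule card_inj_nat_less)+
  have "separators X U \<subseteq> separators X' U \<union> S"
    using separators_adjacent[OF adj _ U] by (auto simp: S_def simp flip: not_le)
  then have "card (separators X U) \<le> card (separators X' U \<union> S)"
    using S finite_separators X U by (intro card_mono) auto
  also have "\<dots> \<le> card (separators X' U) + card S"
    by (rule card_Un_le)
  finally show ?thesis
    using S by simp
qed

lemma point_separators:
  assumes x: "x \<in> disjoint_union \<Y>" and U: "U \<in> \<M>" "fst x \<noteq> U" and v: "v \<in> disjoint_union \<Y>"
    and UV: "fst v \<noteq> U" and large: "of_nat K < pdist U x v"
  shows "U \<in> separators (fst x) (fst v)"
  using assms by (auto simp: separators_def pdist_eq_proj_dist)

text \<open>The comparison of \<open>separators_linear\<close> for points, where \<open>x\<close> or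
  \<open>z\<close> may lie in one of the members compared. Since \<open>fst u\<close> and
  \<open>fst v\<close> differ, \<open>u\<close> and \<open>v\<close> enter only through their
  members.\<close>

lemma pdist_linear:
  assumes x: "x \<in> disjoint_union \<Y>" and z: "z \<in> disjoint_union \<Y>"
    and u: "u \<in> disjoint_union \<Y>" and v: "v \<in> disjoint_union \<Y>" and uv: "fst u \<noteq> fst v"
    and U: "of_nat K < pdist (fst u) x z" and V: "of_nat K < pdist (fst v) x z"
  shows "of_nat K < pdist (fst u) x v \<or> of_nat K < pdist (fst v) x u"
proof -
  have mem: "fst u \<in> \<M>" "fst v \<in> \<M>"
    using u v by (auto simp: disjoint_union_iff)
  have "of_nat K < pdist (fst u) x v + pdist (fst u) v z"
    using pdist_triangle[OF mem(1) x v z] U by (rule less_le_trans[rotated])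
  then consider "of_nat \<theta> < pdist (fst u) x v" | "of_nat \<theta> < pdist (fst u) v z"
    using large_summand by blast
  then show ?thesis
  proof cases
    case 1
    then have "point_proj (fst v) x = point_proj (fst v) u"
      using uv by (intro point_proj_eq_of_large[OF mem(2) mem(1) _ x]) (auto simp: pdist_commute)
    then have "pdist (fst v) x z = pdist (fst v) u z"
      by (rule pdist_cong)
    then have "of_nat \<theta> < pdist (fst v) u z"
      using V by (simp add: theta_less)
    then have "point_proj (fst u) z = point_proj (fst u) v"
      using uv by (intro point_proj_eq_of_large[OF mem _ z]) auto
    then show ?thesis
      using U pdist_cong pdist_commute by metis
  next
    case 2
    then have "point_proj (fst v) z = point_proj (fst v) u"
      using uv by (intro point_proj_eq_of_large[OF mem(2) mem(1) _ z]) auto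
    then show ?thesis
      using V pdist_cong pdist_commute by metis
  qed
qed

text \<open>\<open>fst x\<close> is left out because it has position 0, which another element may
  share. The member containing \<open>z\<close> may belong to the set, hence \<open>pdist\<close> in
  place of \<open>separators\<close>.\<close>

lemma inj_on_card_separators_points:
  assumes x: "x \<in> disjoint_union \<Y>" and z: "z \<in> disjoint_union \<Y>"
  shows "inj_on (\<lambda>U. card (separators (fst x) U)) ({U \<in> \<M>. of_nat K < pdist U x z} - {fst x})"
proof (rule inj_onI, rule ccontr)
  fix U V assume UV: "U \<in> {U \<in> \<M>. of_nat K < pdist U x z} - {fst x}"
    "V \<in> {U \<in> \<M>. of_nat K < pdist U x z} - {fst x}"
    "card (separators (fst x) U) = card (separators (fst x) V)" "U \<noteq> V"
  obtain p q where u: "(U, p) \<in> disjoint_union \<Y>" and v: "(V, q) \<in> disjoint_union \<Y>"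
    using obtain_point UV by (metis DiffD1 mem_Collect_eq)
  have X: "fst x \<in> \<M>"
    using x by (simp add: disjoint_union_iff)
  have "of_nat K < pdist U x (V, q) \<or> of_nat K < pdist V x (U, p)"
    using pdist_linear[OF x z u v] UV by simp
  then have "U \<in> separators (fst x) V \<or> V \<in> separators (fst x) U"
    using point_separators[OF x, of U "(V, q)"] point_separators[OF x, of V "(U, p)"] u v UV by auto
  then show False
    using card_separators_less[of U "fst x" V] card_separators_less[of V "fst x" U] UV X by auto
qed

end

section \<open>The metric of the quasi-tree\<close>

context quasi_tree_of_spaces
begin

abbreviation "QT \<equiv> quasi_tree \<Y> K"

abbreviation vertex_point :: "'i \<times> 'v \<Rightarrow> 'i \<times> ('v, 'e) point" where
  "vertex_point u \<equiv> (fst u, Vertex (snd u))"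

definition bridge :: "'i \<times> 'v \<Rightarrow> 'i \<times> 'v \<Rightarrow> bool" where
  "bridge u w \<longleftrightarrow> proj_complex_adj \<Y> K (fst u) (fst w) \<and>
     snd u \<in> proj \<Y> (fst u) (fst w) \<and> snd w \<in> proj \<Y> (fst w) (fst u)"

lemma bridge_commute: "bridge u w = bridge w u"
  by (auto simp: bridge_def proj_complex_adj_commute)

lemma qt_verts: "v \<in> verts (digraph QT) \<longleftrightarrow> fst v \<in> \<M> \<and> snd v \<in> verts (digraph (graph \<Y> (fst v)))"
  by (cases v) (auto simp: quasi_tree_def qt_digraph_def)

lemma qt_arc_Old [simp]:
  "Old (Y, a) \<in> arcs (digraph QT) \<longleftrightarrow> Y \<in> \<M> \<and> a \<in> arcs (digraph (graph \<Y> Y))"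
  by (auto simp: quasi_tree_def qt_digraph_def)

lemma qt_arc_Bridge [simp]: "Bridge u w \<in> arcs (digraph QT) \<longleftrightarrow> bridge u w"
  by (cases u; cases w)
    (auto simp: quasi_tree_def qt_digraph_def bridge_def proj_complex_adj_commute)

lemma qt_arc_cases:
  assumes "b \<in> arcs (digraph QT)"
  obtains (Old) Y a where "b = Old (Y, a)" "Y \<in> \<M>" "a \<in> arcs (digraph (graph \<Y> Y))"
  | (Bridge) u w where "b = Bridge u w" "bridge u w"
  using assms by (cases b) auto

lemma qt_ends [simp]:
  "tail (digraph QT) (Old (Y, a)) = (Y, tail (digraph (graph \<Y> Y)) a)"
  "head (digraph QT) (Old (Y, a)) = (Y, head (digraph (graph \<Y> Y)) a)"
  "tail (digraph QT) (Bridge u w) = u" "head (digraph QT) (Bridge u w) = w"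
  by (simp_all add: quasi_tree_def qt_digraph_def)

lemma qt_len [simp]:
  "len QT (Old (Y, a)) = len (graph \<Y> Y) a" "len QT (Bridge u w) = real K"
  by (simp_all add: quasi_tree_def)

lemma qt_reversal_Old:
  "\<lbrakk>Y \<in> \<M>; a \<in> arcs (digraph (graph \<Y> Y))\<rbrakk> \<Longrightarrow> reversal QT (Old (Y, a)) = Old (Y, reversal (graph \<Y> Y) a)"
  using qt_arc_Old[of Y a] by (simp add: quasi_tree_def)

lemma qt_reversal_Bridge: "bridge u w \<Longrightarrow> reversal QT (Bridge u w) = Bridge w u"
  using qt_arc_Bridge[of u w] by (simp add: quasi_tree_def)

lemma bridge_vertex_point:
  assumes "bridge u w"
  shows "vertex_point u \<in> disjoint_union \<Y>" "fst u \<noteq> fst w" "fst u \<in> \<M>"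
    "snd u \<in> verts (digraph (graph \<Y> (fst u)))"
  using assms proj_vertices[of "fst w" "fst u"]
  by (auto simp: bridge_def adjacent_iff disjoint_union_iff intro!: vertex_in_realization)

lemma qt_bidirected: "bidirected_digraph (digraph QT) (reversal QT)"
proof -
  have graph: "bidirected_digraph (digraph (graph \<Y> Y)) (reversal (graph \<Y> Y))" if "Y \<in> \<M>" for Y
    using graphs[OF that] by (simp add: connected_unit_graph_def)
  interpret Q: wf_digraph "digraph QT"
  proof
    fix b assume "b \<in> arcs (digraph QT)"
    then show "tail (digraph QT) b \<in> verts (digraph QT)"
    proof (cases rule: qt_arc_cases)
      case (Old Y a)
      then interpret Y: bidirected_digraph "digraph (graph \<Y> Y)" "reversal (graph \<Y> Y)"
        using graph by blast
      show ?thesis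
        using Old by (simp add: qt_verts)
    qed (simp add: qt_verts bridge_vertex_point)
  next
    fix b assume "b \<in> arcs (digraph QT)"
    then show "head (digraph QT) b \<in> verts (digraph QT)"
    proof (cases rule: qt_arc_cases)
      case (Old Y a)
      then interpret Y: bidirected_digraph "digraph (graph \<Y> Y)" "reversal (graph \<Y> Y)"
        using graph by blast
      show ?thesis
        using Old by (simp add: qt_verts)
    next
      case (Bridge u w)
      then show ?thesis
        using bridge_vertex_point[of w u] by (simp add: qt_verts bridge_commute)
    qed
  qed
  show ?thesis
  proof (rule Q.bidirected_digraphI)
    fix b assume "b \<notin> arcs (digraph QT)"
    then show "reversal QT b = b"
      by (simp add: quasi_tree_def)
  next
    fix b assume "b \<in> arcs (digraph QT)"
    then have "reversal QT b \<noteq> b \<and> reversal QT (reversal QT b) = b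
      \<and> tail (digraph QT) (reversal QT b) = head (digraph QT) b"
    proof (cases rule: qt_arc_cases)
      case (Old Y a)
      then interpret Y: bidirected_digraph "digraph (graph \<Y> Y)" "reversal (graph \<Y> Y)"
        using graph by blast
      show ?thesis
        using Old Y.arev_neq[of a] by (simp add: qt_reversal_Old)
    next
      case (Bridge u w)
      then show ?thesis
        using bridge_vertex_point(2)[of u w] bridge_commute[of u w]
        by (auto simp: qt_reversal_Bridge)
    qed
    then show "reversal QT b \<noteq> b" "reversal QT (reversal QT b) = b"
      "tail (digraph QT) (reversal QT b) = head (digraph QT) b"
      by auto
  qed
qed

lemma qt_incl_edge_point:
  assumes "Y \<in> \<M>" "a \<in> arcs (digraph (graph \<Y> Y))"
  shows "edge_point QT (Old (Y, a)) t = qt_incl (Y, edge_point (graph \<Y> Y) a t)"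
  using assms by (simp add: edge_point_def qt_reversal_Old)

lemma qt_incl_vertex_point [simp]: "qt_incl (vertex_point u) = Vertex u"
  by simp

lemma qt_incl_in_realization: "x \<in> disjoint_union \<Y> \<Longrightarrow> qt_incl x \<in> realization QT"
proof -
  assume "x \<in> disjoint_union \<Y>"
  then obtain Y p where x: "x = (Y, p)" "Y \<in> \<M>" "p \<in> realization (graph \<Y> Y)"
    by (auto simp: disjoint_union_def)
  then interpret connected_metric_graph "graph \<Y> Y"
    by (intro member_graph)
  from x(3) show ?thesis
  proof (cases rule: realization_cases)
    case (vertex v)
    then show ?thesis
      using x by (auto intro!: vertex_in_realization simp: qt_verts)
  next
    case (interior a t)
    then show ?thesis
      using x edge_point_in_realization[of "Old (Y, a)" QT t] by (simp add: qt_incl_edge_point)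
  qed
qed

lemma qt_realization_cases:
  assumes "z \<in> realization QT"
  obtains (incl) x where "x \<in> disjoint_union \<Y>" "z = qt_incl x"
  | (bridge) u w t where "bridge u w" "0 < t" "t < real K" "z = edge_point QT (Bridge u w) t"
proof -
  have vertex: thesis if "z = Vertex v" "v \<in> verts (digraph QT)" for v
    using that incl[of "vertex_point v"]
    by (auto simp: qt_verts disjoint_union_iff intro!: vertex_in_realization)
  from assms show thesis
    unfolding realization_def
  proof (elim UnE imageE CollectE exE conjE)
    fix v assume "z = Vertex v" "v \<in> verts (digraph QT)"
    then show thesis
      by (rule vertex)
  next
    fix b t assume b: "b \<in> arcs (digraph QT)" and z: "z = edge_point QT b t"
      and t: "0 \<le> t" "t \<le> len QT b"
    from b show thesis
    proof (cases rule: qt_arc_cases)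
      case (Old Y a)
      then show thesis
        using incl[of "(Y, edge_point (graph \<Y> Y) a t)"] z t
        by (simp add: disjoint_union_iff qt_incl_edge_point edge_point_in_realization)
    next
      case (Bridge u w)
      interpret bidirected_digraph "digraph QT" "reversal QT"
        by (rule qt_bidirected)
      consider "t = 0" | "t = real K" | "0 < t \<and> t < real K"
        using t Bridge by fastforce
      then show thesis
      proof cases
        case 1
        then show thesis
          using vertex[of u] z tail_in_verts[OF b] Bridge by simp
      next
        case 2
        then show thesis
          using vertex[of w] z head_in_verts[OF b] Bridge K_pos by (simp add: edge_point_def)
      next
        case 3
        then show thesis
          using bridge z Bridge by blast
      qed
    qed
  qed
qed

section \<open>Connectedness of the quasi-tree\<close>

lemma pl_path_qt_incl:
  assumes "Y \<in> \<M>"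
  shows "pl_path (graph \<Y> Y) p q l \<Longrightarrow> pl_path QT (qt_incl (Y, p)) (qt_incl (Y, q)) l"
proof (induction rule: pl_path.induct)
  case (refl x)
  then show ?case
    using assms by (intro pl_path.refl qt_incl_in_realization) (simp add: disjoint_union_iff)
next
  case (step a s t y l)
  then show ?case
    using pl_path.step[of "Old (Y, a)" QT s t "qt_incl (Y, y)" l] assms
    by (simp add: qt_incl_edge_point)
qed

lemma pl_path_bridge: "bridge u w \<Longrightarrow> pl_path QT (Vertex u) (Vertex w) (real K)"
  using pl_path_edge[of "Bridge u w" QT 0 "real K"] K_pos by (simp add: edge_point_def)

lemma adjacent_bridge:
  assumes "proj_complex_adj \<Y> K X Z"
  obtains p q where "bridge (X, p) (Z, q)"
  using assms proj_nonempty[of X Z] proj_nonempty[of Z X]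
  by (force simp: bridge_def adjacent_iff)

lemma pl_path_piece:
  assumes "(Y, p) \<in> disjoint_union \<Y>" "(Y, q) \<in> disjoint_union \<Y>"
  shows "\<exists>l. pl_path QT (qt_incl (Y, p)) (qt_incl (Y, q)) l"
proof -
  have Y: "Y \<in> \<M>" "p \<in> realization (graph \<Y> Y)" "q \<in> realization (graph \<Y> Y)"
    using assms by (auto simp: disjoint_union_iff)
  then interpret connected_metric_graph "graph \<Y> Y"
    by (intro member_graph)
  show ?thesis
    using joined[OF Y(2,3)] pl_path_qt_incl[OF Y(1)] by blast
qed

text \<open>Induction on the number of separators. With none, the two members coincide or are joined
  by a bridge; otherwise the path is routed through a separator, and both halves have strictly
  fewer.\<close>

lemma pl_path_incl:
  "\<lbrakk>x \<in> disjoint_union \<Y>; z \<in> disjoint_union \<Y>\<rbrakk> \<Longrightarrow> \<exists>l. pl_path QT (qt_incl x) (qt_incl z) l"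
proof (induction "card (separators (fst x) (fst z))" arbitrary: x z rule: less_induct)
  case less
  note x = less.prems(1) and z = less.prems(2)
  have mem: "fst x \<in> \<M>" "fst z \<in> \<M>"
    using x z by (auto simp: disjoint_union_iff)
  consider "fst x = fst z" | "proj_complex_adj \<Y> K (fst x) (fst z)" | U where "U \<in> separators (fst x) (fst z)"
    using mem by (auto simp: adjacent_iff)
  then show ?case
  proof cases
    case 1
    then show ?thesis
      using pl_path_piece[of "fst x" "snd x" "snd z"] x z by (cases x; cases z) simp
  next
    case 2
    then obtain p q where b: "bridge (fst x, p) (fst z, q)"
      by (rule adjacent_bridge)
    have "\<exists>l. pl_path QT (qt_incl x) (Vertex (fst x, p)) l"
      using pl_path_piece[of "fst x" "snd x" "Vertex p"] x bridge_vertex_point(1)[OF b] by simp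
    moreover have "\<exists>l. pl_path QT (Vertex (fst z, q)) (qt_incl z) l"
      using pl_path_piece[of "fst z" "Vertex q" "snd z"] z b
        bridge_vertex_point(1)[of "(fst z, q)" "(fst x, p)"] by (simp add: bridge_commute)
    ultimately show ?thesis
      using pl_path_bridge[OF b] by (blast intro: pl_path_trans)
  next
    case 3
    obtain p where u: "(U, p) \<in> disjoint_union \<Y>"
      using separatorsD(1)[OF 3 mem] by (rule obtain_point)
    have "card (separators (fst x) U) < card (separators (fst x) (fst z))"
      "card (separators U (fst z)) < card (separators (fst x) (fst z))"
      using card_separators_less[OF 3 mem] card_separators_less[of U "fst z" "fst x"] 3 mem
      by (simp_all add: separators_commute)
    then have "\<exists>l. pl_path QT (qt_incl x) (qt_incl (U, p)) l"
      "\<exists>l. pl_path QT (qt_incl (U, p)) (qt_incl z) l"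
      using less.hyps x z u by simp_all
    then show ?thesis
      by (blast intro: pl_path_trans)
  qed
qed

sublocale QT: connected_metric_graph QT
proof (rule connected_metric_graph.intro[OF qt_bidirected])
  fix b assume b: "b \<in> arcs (digraph QT)"
  then show "len QT (reversal QT b) = len QT b"
  proof (cases rule: qt_arc_cases)
    case (Old Y a)
    then interpret connected_metric_graph "graph \<Y> Y"
      by (intro member_graph)
    show ?thesis
      using Old len_reversal[of a] by (simp add: qt_reversal_Old)
  qed (simp add: qt_reversal_Bridge)
  show "1 \<le> len QT b"
    using b
  proof (cases rule: qt_arc_cases)
    case (Old Y a)
    then interpret connected_metric_graph "graph \<Y> Y"
      by (intro member_graph)
    show ?thesis
      using Old len_ge_1[of a] by simp
  qed (use K_pos in simp)
next
  have to_incl: "\<exists>x\<in>disjoint_union \<Y>. \<exists>l. pl_path QT z (qt_incl x) l" if z: "z \<in> realization QT" for z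
    using z
  proof (cases rule: qt_realization_cases)
    case (incl x)
    then show ?thesis
      using z by (blast intro: pl_path.refl)
  next
    case (bridge u w t)
    then have "pl_path QT z (qt_incl (vertex_point u)) \<bar>t - 0\<bar>"
      using pl_path_edge[of "Bridge u w" QT t 0] by simp
    then show ?thesis
      using bridge_vertex_point(1)[OF bridge(1)] by blast
  qed
  fix y z assume "y \<in> realization QT" "z \<in> realization QT"
  then obtain x l x' l' where "x \<in> disjoint_union \<Y>" "pl_path QT y (qt_incl x) l"
    "x' \<in> disjoint_union \<Y>" "pl_path QT z (qt_incl x') l'"
    using to_incl by blast
  then show "\<exists>l. pl_path QT y z l"
    using pl_path_incl[of x x'] by (blast intro: pl_path_trans pl_path_sym)
qed

lemma path_dist_qt_incl:
  assumes "(Y, p) \<in> disjoint_union \<Y>" "(Y, q) \<in> disjoint_union \<Y>"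
  shows "path_dist QT (qt_incl (Y, p)) (qt_incl (Y, q)) \<le> path_dist (graph \<Y> Y) p q"
proof -
  have Y: "Y \<in> \<M>" "p \<in> realization (graph \<Y> Y)" "q \<in> realization (graph \<Y> Y)"
    using assms by (auto simp: disjoint_union_iff)
  then interpret connected_metric_graph "graph \<Y> Y"
    by (intro member_graph)
  show ?thesis
    using Y by (intro path_dist_greatest path_dist_le pl_path_qt_incl)
qed

section \<open>Upper bound for distances in the quasi-tree\<close>

abbreviation qdist :: "'i \<times> ('v, 'e) point \<Rightarrow> 'i \<times> ('v, 'e) point \<Rightarrow> real" where
  "qdist x z \<equiv> path_dist QT (qt_incl x) (qt_incl z)"

lemma qdist_triangle:
  "\<lbrakk>x \<in> disjoint_union \<Y>; y \<in> disjoint_union \<Y>; z \<in> disjoint_union \<Y>\<rbrakk>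
   \<Longrightarrow> qdist x z \<le> qdist x y + qdist y z"
  by (intro QT.path_dist_triangle qt_incl_in_realization)

lemma path_dist_le_pdist:
  assumes "p \<in> point_proj U x" "q \<in> point_proj U z" "pdist U x z \<le> ennreal R" "0 \<le> R"
  shows "path_dist (graph \<Y> U) p q \<le> R"
  using order_trans[OF pdist_upper[OF assms(1,2)] assms(3)] assms(4) by simp

text \<open>Between adjacent members there is a path made of two stretches of length about
  \<open>R\<close> and one bridge, which gives \<open>2 * R + K\<close>. Otherwise the path is cut
  at a separator; each half has fewer separators and still has all projection distances at most
  \<open>R\<close>, so the bound doubles.\<close>

lemma qdist_le:
  assumes R: "real \<theta> \<le> R"
  shows "\<lbrakk>x \<in> disjoint_union \<Y>; z \<in> disjoint_union \<Y>; card (separators (fst x) (fst z)) \<le> n;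
    \<And>U. U \<in> \<M> \<Longrightarrow> pdist U x z \<le> ennreal R\<rbrakk> \<Longrightarrow> qdist x z \<le> 2 ^ n * (2 * R + real K)"
proof (induction n arbitrary: x z rule: less_induct)
  case (less n)
  note x = less.prems(1) and z = less.prems(2) and bound = less.prems(4)
  have R0: "0 \<le> R"
    using R by (rule order_trans[rotated]) simp
  have mem: "fst x \<in> \<M>" "fst z \<in> \<M>"
    using x z by (auto simp: disjoint_union_iff)
  have n_pos: "2 * R + real K \<le> 2 ^ n * (2 * R + real K)"
    using mult_right_mono[of 1 "2 ^ n" "2 * R + real K"] R0 by simp
  consider (same) "fst x = fst z" | (adj) "proj_complex_adj \<Y> K (fst x) (fst z)"
    | (split) U where "U \<in> separators (fst x) (fst z)"
    using mem by (auto simp: adjacent_iff)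
  then show ?case
  proof cases
    case same
    have "qdist x z \<le> path_dist (graph \<Y> (fst x)) (snd x) (snd z)"
      using path_dist_qt_incl[of "fst x" "snd x" "snd z"] same x z by (cases x; cases z) simp
    also have "\<dots> \<le> R"
      by (rule path_dist_le_pdist[OF _ _ bound R0]) (use same mem in \<open>simp_all add: point_proj_def\<close>)
    finally show ?thesis
      using n_pos R0 by linarith
  next
    case adj
    then obtain p q where b: "bridge (fst x, p) (fst z, q)"
      by (rule adjacent_bridge)
    then have p: "(fst x, Vertex p) \<in> disjoint_union \<Y>" and q: "(fst z, Vertex q) \<in> disjoint_union \<Y>"
      using bridge_vertex_point(1)[OF b] bridge_vertex_point(1)[OF b[unfolded bridge_commute[of "(fst x, p)"]]]
      by simp_all
    have "qdist x (fst x, Vertex p) \<le> path_dist (graph \<Y> (fst x)) (snd x) (Vertex p)"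
      using path_dist_qt_incl[of "fst x" "snd x" "Vertex p"] x p by simp
    also have "\<dots> \<le> R"
      by (rule path_dist_le_pdist[OF _ _ bound R0])
        (use b mem in \<open>auto simp: point_proj_def bridge_def adjacent_iff\<close>)
    finally have 1: "qdist x (fst x, Vertex p) \<le> R" .
    have "qdist (fst z, Vertex q) z \<le> path_dist (graph \<Y> (fst z)) (Vertex q) (snd z)"
      using path_dist_qt_incl[of "fst z" "Vertex q" "snd z"] z q by simp
    also have "\<dots> \<le> R"
      by (rule path_dist_le_pdist[OF _ _ bound R0])
        (use b mem in \<open>auto simp: point_proj_def bridge_def adjacent_iff\<close>)
    finally have 2: "qdist (fst z, Vertex q) z \<le> R" .
    have 3: "qdist (fst x, Vertex p) (fst z, Vertex q) \<le> real K"
      using path_dist_le[OF pl_path_bridge[OF b]] by simp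
    have "qdist x z \<le> qdist x (fst x, Vertex p)
        + (qdist (fst x, Vertex p) (fst z, Vertex q) + qdist (fst z, Vertex q) z)"
      using qdist_triangle[OF x p z] qdist_triangle[OF p q z] by linarith
    then show ?thesis
      using 1 2 3 n_pos by linarith
  next
    case (split U)
    note U = separatorsD[OF split mem]
    obtain p where p: "p \<in> proj \<Y> U (fst x)"
      using proj_nonempty[of "fst x" U] U mem by blast
    \<comment> \<open>The cut point is taken in the projection of \<open>x\<close> to
      \<open>U\<close>. At \<open>U\<close> itself the first half then costs at most \<theta>, and
      the second at most what \<open>x\<close> and \<open>z\<close> cost.\<close>
    define u where "u = (U, Vertex p :: ('v, 'e) point)"
    have u: "u \<in> disjoint_union \<Y>" and fst_u: "fst u = U"
      using p proj_vertices[of "fst x" U] U mem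
      by (auto simp: u_def disjoint_union_iff intro!: vertex_in_realization)
    have sub: "point_proj U u \<subseteq> point_proj U x"
      using p U by (auto simp: u_def point_proj_def)
    have large: "of_nat \<theta> < pdist U x z"
      using U mem by (simp add: pdist_eq_proj_dist)
    have theta: "(of_nat \<theta> :: ennreal) \<le> ennreal R"
      using R by (simp add: ennreal_of_nat_eq_real_of_nat ennreal_leI)
    have xu: "pdist V x u \<le> ennreal R" if V: "V \<in> \<M>" for V
    proof (cases "V = U")
      case True
      have "pdist U x u \<le> pdist U x x"
        unfolding pdist_def diam_le_iff[of _ "_ \<union> point_proj U u"]
        using sub by (intro ballI diam_upper) blast+
      then show ?thesis
        using True pdist_self[OF U(1) x] theta by (meson order_trans)
    next
      case False
      obtain q where v: "(V, q) \<in> disjoint_union \<Y>"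
        using V by (rule obtain_point)
      \<comment> \<open>If the distance at \<open>V\<close> exceeds \<theta>, two uses of (P1') show
        that \<open>V\<close> sees \<open>u\<close> where it sees \<open>z\<close>, so the bound for
        \<open>x\<close> and \<open>z\<close> applies. The other half is treated the same way with
        the ends exchanged.\<close>
      show ?thesis
      proof (cases "of_nat \<theta> < pdist V u x")
        case True
        then have "point_proj U x = point_proj U (V, q)"
          using False fst_u by (intro point_proj_eq_of_large[OF U(1) V _ x]) auto
        then have "of_nat \<theta> < pdist U (V, q) z"
          using large by (simp add: pdist_def)
        then have "point_proj V z = point_proj V u"
          using False fst_u by (intro point_proj_eq_of_large[OF V U(1) _ z]) auto
        then show ?thesis
          using bound[OF V] by (simp add: pdist_def)
      qed (use theta in \<open>simp add: pdist_commute not_less\<close>)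
    qed
    have uz: "pdist V u z \<le> ennreal R" if V: "V \<in> \<M>" for V
    proof (cases "V = U")
      case True
      have "pdist U u z \<le> pdist U x z"
        unfolding pdist_def diam_le_iff[of _ "point_proj U u \<union> _"]
        using sub by (intro ballI diam_upper) blast+
      then show ?thesis
        using True bound[OF U(1)] by (meson order_trans)
    next
      case False
      obtain q where v: "(V, q) \<in> disjoint_union \<Y>"
        using V by (rule obtain_point)
      show ?thesis
      proof (cases "of_nat \<theta> < pdist V u z")
        case True
        then have "point_proj U z = point_proj U (V, q)"
          using False fst_u by (intro point_proj_eq_of_large[OF U(1) V _ z]) auto
        then have "of_nat \<theta> < pdist U (V, q) x"
          using large by (simp add: pdist_def Un_commute)
        then have "point_proj V x = point_proj V u"
          using False fst_u by (intro point_proj_eq_of_large[OF V U(1) _ x]) auto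
        then show ?thesis
          using bound[OF V] by (simp add: pdist_def)
      qed (use theta in \<open>simp add: not_less\<close>)
    qed
    have "card (separators (fst x) U) < n" "card (separators U (fst z)) < n"
      using card_separators_less[OF split mem] card_separators_less[of U "fst z" "fst x"] split mem less.prems(3)
      by (simp_all add: separators_commute)
    then obtain m where n: "n = Suc m" and m: "card (separators (fst x) U) \<le> m" "card (separators U (fst z)) \<le> m"
      by (cases n) auto
    have "qdist x z \<le> qdist x u + qdist u z"
      using x u z by (rule qdist_triangle)
    also have "\<dots> \<le> 2 ^ m * (2 * R + real K) + 2 ^ m * (2 * R + real K)"
      using m x z u xu uz n by (intro add_mono less.IH) (auto simp: fst_u)
    finally show ?thesis
      by (simp add: n)
  qed
qed

end

section \<open>Lipschitz functions on the quasi-tree\<close>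

context quasi_tree_of_spaces
begin

text \<open>Linear interpolation over the bridges extends \<open>f\<close> to the whole quasi-tree;
  a variation of at most \<open>K\<close> over a bridge of length \<open>K\<close> keeps it
  1-Lipschitz. All lower bounds on \<open>qdist\<close> below use this.\<close>

lemma lipschitz_qdist:
  fixes f :: "'i \<times> ('v, 'e) point \<Rightarrow> real"
  assumes pieces: "\<And>Y p q. \<lbrakk>(Y, p) \<in> disjoint_union \<Y>; (Y, q) \<in> disjoint_union \<Y>\<rbrakk>
      \<Longrightarrow> \<bar>f (Y, p) - f (Y, q)\<bar> \<le> path_dist (graph \<Y> Y) p q"
    and bridges: "\<And>u w. bridge u w \<Longrightarrow> \<bar>f (vertex_point u) - f (vertex_point w)\<bar> \<le> real K"
    and x: "x \<in> disjoint_union \<Y>" and y: "y \<in> disjoint_union \<Y>"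
  shows "\<bar>f x - f y\<bar> \<le> qdist x y"
proof -
  define H where "H b t = (case b of Old (Y, a) \<Rightarrow> f (Y, edge_point (graph \<Y> Y) a t)
    | Bridge u w \<Rightarrow> f (vertex_point u) + t / real K * (f (vertex_point w) - f (vertex_point u)))"
    for b :: "('i \<times> 'e, 'i \<times> 'v) qt_arc" and t :: real
  have H_Old: "H (Old (Y, a)) t = f (Y, edge_point (graph \<Y> Y) a t)" for Y a t
    by (simp add: H_def)
  have H_Bridge: "H (Bridge u w) t
      = f (vertex_point u) + t / real K * (f (vertex_point w) - f (vertex_point u))" for u w t
    by (simp add: H_def)
  have "\<exists>F. (\<forall>v. F (Vertex v) = f (vertex_point v))
    \<and> (\<forall>b\<in>arcs (digraph QT). \<forall>t\<in>{0..len QT b}. F (edge_point QT b t) = H b t)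
    \<and> (\<forall>x\<in>realization QT. \<forall>y\<in>realization QT. \<bar>F x - F y\<bar> \<le> path_dist QT x y)"
  proof (rule QT.lipschitz_edge_function)
    fix b t assume b: "b \<in> arcs (digraph QT)" and t: "0 \<le> t" "t \<le> len QT b"
    from b show "H (reversal QT b) (len QT b - t) = H b t"
    proof (cases rule: qt_arc_cases)
      case (Old Y a)
      then interpret Y: connected_metric_graph "graph \<Y> Y"
        by (intro member_graph)
      show ?thesis
        using Old by (simp add: qt_reversal_Old H_Old Y.edge_point_reversal)
    next
      case (Bridge u w)
      then show ?thesis
        using K_pos by (simp add: qt_reversal_Bridge H_Bridge field_simps)
    qed
  next
    fix b assume "b \<in> arcs (digraph QT)"
    then show "H b 0 = f (vertex_point (tail (digraph QT) b))"
      by (cases rule: qt_arc_cases) (simp_all add: H_Old H_Bridge)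
  next
    fix b s t assume b: "b \<in> arcs (digraph QT)" and s: "s \<in> {0..len QT b}" and t: "t \<in> {0..len QT b}"
    from b show "\<bar>H b s - H b t\<bar> \<le> \<bar>s - t\<bar>"
    proof (cases rule: qt_arc_cases)
      case (Old Y a)
      then have "\<bar>H b s - H b t\<bar>
          \<le> path_dist (graph \<Y> Y) (edge_point (graph \<Y> Y) a s) (edge_point (graph \<Y> Y) a t)"
        using s t by (auto simp: H_Old disjoint_union_iff edge_point_in_realization intro!: pieces)
      also have "\<dots> \<le> \<bar>s - t\<bar>"
        using Old s t by (intro path_dist_edge) auto
      finally show ?thesis .
    next
      case (Bridge u w)
      have "H b s - H b t = (s - t) * ((f (vertex_point w) - f (vertex_point u)) / real K)"
        using Bridge K_pos by (simp add: H_Bridge field_simps)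
      then have "\<bar>H b s - H b t\<bar> = \<bar>s - t\<bar> * (\<bar>f (vertex_point w) - f (vertex_point u)\<bar> / real K)"
        by (simp add: abs_mult)
      also have "\<dots> \<le> \<bar>s - t\<bar> * 1"
        using bridges[OF Bridge(2)] K_pos by (intro mult_left_mono) (auto simp: abs_minus_commute)
      finally show ?thesis
        by simp
    qed
  qed
  then obtain F where "\<forall>v. F (Vertex v) = f (vertex_point v)"
    "\<forall>b\<in>arcs (digraph QT). \<forall>t\<in>{0..len QT b}. F (edge_point QT b t) = H b t"
    "\<forall>x\<in>realization QT. \<forall>y\<in>realization QT. \<bar>F x - F y\<bar> \<le> path_dist QT x y"
    by blast
  note F = this[rule_format]
  have F_incl: "F (qt_incl z) = f z" if z: "z \<in> disjoint_union \<Y>" for z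
  proof -
    obtain Y p where Yp: "z = (Y, p)" "Y \<in> \<M>" "p \<in> realization (graph \<Y> Y)"
      using z by (auto simp: disjoint_union_def)
    then interpret Y: connected_metric_graph "graph \<Y> Y"
      by (intro member_graph)
    from Yp(3) show ?thesis
    proof (cases rule: Y.realization_cases)
      case (vertex v)
      then show ?thesis
        using F(1)[of "(Y, v)"] Yp by simp
    next
      case (interior a t)
      then show ?thesis
        using F(2)[of "Old (Y, a)" t] Yp by (simp add: H_Old qt_incl_edge_point)
    qed
  qed
  show ?thesis
    using F(3)[OF qt_incl_in_realization[OF x] qt_incl_in_realization[OF y]] F_incl x y by simp
qed

text \<open>If \<open>U\<close> contains an end of the bridge, that end lies in the projection of
  the other member, so only the diameter bound \<theta> is paid. For all other \<open>U\<close> the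
  bound is the definition of adjacency.\<close>

lemma bridge_pdist:
  assumes b: "bridge u w" and U: "U \<in> \<M>"
  shows "pdist U (vertex_point u) (vertex_point w) \<le> of_nat K"
proof -
  have theta: "of_nat \<theta> \<le> (of_nat K :: ennreal)"
    using K_large by simp
  have end_in: "pdist U (vertex_point u) (vertex_point w) \<le> of_nat K"
    if b: "bridge u w" and U: "U = fst u" for u w
  proof -
    have "point_proj U (vertex_point u) \<subseteq> point_proj U (vertex_point w)"
      using b U bridge_vertex_point(2)[OF b] by (auto simp: point_proj_def bridge_def)
    then have "pdist U (vertex_point u) (vertex_point w) \<le> pdist U (vertex_point w) (vertex_point w)"
      unfolding pdist_def diam_le_iff[of _ "_ \<union> point_proj U (vertex_point w)"]
      by (intro ballI diam_upper) blast+
    also have "\<dots> \<le> of_nat \<theta>"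
      using bridge_vertex_point[OF b] bridge_vertex_point[of w u] b U
      by (intro pdist_self) (simp_all add: bridge_commute)
    finally show ?thesis
      using theta by (rule order_trans)
  qed
  consider "U = fst u" | "U = fst w" | "U \<noteq> fst u" "U \<noteq> fst w"
    by blast
  then show ?thesis
  proof cases
    case 1
    then show ?thesis
      using b end_in by blast
  next
    case 2
    then show ?thesis
      using b end_in[of w u] by (simp add: bridge_commute pdist_commute)
  next
    case 3
    then show ?thesis
      using b U by (simp add: pdist_eq_proj_dist bridge_def proj_complex_adj_def)
  qed
qed

text \<open>Coarse Lipschitz property of projections: the distance from \<open>rep x\<close> to a
  representative of the projection of a moving point satisfies \<open>lipschitz_qdist\<close>.
  Passing from representatives to arbitrary points of the two projections costs \<theta> at each
  end.\<close>

lemma pdist_le_qdist: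
  assumes U: "U \<in> \<M>" and x: "x \<in> disjoint_union \<Y>" and z: "z \<in> disjoint_union \<Y>"
  shows "pdist U x z \<le> ennreal (qdist x z + 2 * real \<theta>)"
proof -
  interpret U: connected_metric_graph "graph \<Y> U"
    using U by (rule member_graph)
  let ?d = "path_dist (graph \<Y> U)"
  \<comment> \<open>The choice depends only on the set \<open>point_proj U y\<close>, so
    \<open>rep\<close> is constant on every member other than \<open>U\<close>; this gives the
    Lipschitz condition there.\<close>
  define rep where "rep y = (SOME p. p \<in> point_proj U y)" for y :: "'i \<times> ('v, 'e) point"
  have rep: "rep y \<in> point_proj U y" if "y \<in> disjoint_union \<Y>" for y
    unfolding rep_def some_in_eq using point_proj_nonempty[OF U that] .
  have rep_real: "rep y \<in> realization (graph \<Y> U)" if "y \<in> disjoint_union \<Y>" for y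
    using rep[OF that] point_proj_subset[OF U that] by blast
  have "\<bar>?d (rep x) (rep x) - ?d (rep x) (rep z)\<bar> \<le> qdist x z"
  proof (rule lipschitz_qdist[OF _ _ x z])
    fix Y p q assume p: "(Y, p) \<in> disjoint_union \<Y>" and q: "(Y, q) \<in> disjoint_union \<Y>"
    show "\<bar>?d (rep x) (rep (Y, p)) - ?d (rep x) (rep (Y, q))\<bar> \<le> path_dist (graph \<Y> Y) p q"
    proof (cases "Y = U")
      case True
      then have "rep (Y, p) = p" "rep (Y, q) = q"
        using rep[OF p] rep[OF q] by (auto simp: point_proj_def)
      then show ?thesis
        using True U.path_dist_triangle_abs[OF rep_real[OF x] rep_real[OF p] rep_real[OF q]] by simp
    next
      case False
      then show ?thesis
        by (simp add: rep_def point_proj_def)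
    qed
  next
    fix u w assume b: "bridge u w"
    then have u: "vertex_point u \<in> disjoint_union \<Y>" and w: "vertex_point w \<in> disjoint_union \<Y>"
      using bridge_vertex_point(1) by (auto simp: bridge_commute[of u])
    have "\<bar>?d (rep x) (rep (vertex_point u)) - ?d (rep x) (rep (vertex_point w))\<bar>
        \<le> ?d (rep (vertex_point u)) (rep (vertex_point w))"
      by (intro U.path_dist_triangle_abs rep_real x u w)
    also have "\<dots> \<le> real K"
      using bridge_pdist[OF b U]
      by (intro path_dist_le_pdist[OF rep rep] u w) (simp_all add: ennreal_of_nat_eq_real_of_nat)
    finally show "\<bar>?d (rep x) (rep (vertex_point u)) - ?d (rep x) (rep (vertex_point w))\<bar> \<le> real K" .
  qed
  then have rep_xz: "?d (rep x) (rep z) \<le> qdist x z"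
    using rep_real[OF x] by simp
  have self: "?d p q \<le> real \<theta>" if "p \<in> point_proj U y" "q \<in> point_proj U y" "y \<in> disjoint_union \<Y>" for p q y
    using pdist_self[OF U that(3)] that
    by (intro path_dist_le_pdist[of p U y q y]) (simp_all add: ennreal_of_nat_eq_real_of_nat)
  have cross: "?d p q \<le> qdist x z + 2 * real \<theta>"
    if p: "p \<in> point_proj U x" and q: "q \<in> point_proj U z" for p q
  proof -
    have real: "p \<in> realization (graph \<Y> U)" "q \<in> realization (graph \<Y> U)"
      using p q point_proj_subset[OF U] x z by blast+
    have "?d p q \<le> ?d p (rep x) + ?d (rep x) q" "?d (rep x) q \<le> ?d (rep x) (rep z) + ?d (rep z) q"
      by (intro U.path_dist_triangle real rep_real x z)+
    then show ?thesis
      using self[OF p rep[OF x] x] self[OF rep[OF z] q z] rep_xz by linarith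
  qed
  have near: "?d p q \<le> qdist x z + 2 * real \<theta>"
    if "p \<in> point_proj U y" "q \<in> point_proj U y" "y \<in> disjoint_union \<Y>" for p q y
    using self[OF that] path_dist_nonneg[of QT "qt_incl x" "qt_incl z"]
    by (simp add: add_increasing)
  have "?d p q \<le> qdist x z + 2 * real \<theta>" if "p \<in> point_proj U x \<union> point_proj U z"
    "q \<in> point_proj U x \<union> point_proj U z" for p q
    using that cross[of p q] cross[of q p] near[OF _ _ x, of p q] near[OF _ _ z, of p q]
      path_dist_commute[of "graph \<Y> U" p q] by auto
  then show ?thesis
    unfolding pdist_def diam_le_iff by (intro ballI ennreal_leI)
qed

text \<open>A jump of 2 between neighbours becomes a jump of \<open>K\<close> after scaling by
  \<open>K / 2\<close>, as a bridge permits. Scaling back uses \<open>K \<ge> 1\<close> and gives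
  the factor 2.\<close>

lemma adjacent_lipschitz:
  fixes h :: "'i \<Rightarrow> real"
  assumes h: "\<And>X X'. proj_complex_adj \<Y> K X X' \<Longrightarrow> \<bar>h X - h X'\<bar> \<le> 2"
    and x: "x \<in> disjoint_union \<Y>" and y: "y \<in> disjoint_union \<Y>"
  shows "\<bar>h (fst x) - h (fst y)\<bar> \<le> 2 * qdist x y"
proof -
  have scale: "\<bar>h X * (real K / 2) - h Y * (real K / 2)\<bar> = \<bar>h X - h Y\<bar> * (real K / 2)" for X Y
    unfolding left_diff_distrib[symmetric] abs_mult by simp
  have "\<bar>h (fst x) * (real K / 2) - h (fst y) * (real K / 2)\<bar> \<le> qdist x y"
  proof (rule lipschitz_qdist[OF _ _ x y])
    fix u w assume "bridge u w"
    then have "\<bar>h (fst u) - h (fst w)\<bar> \<le> 2"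
      by (intro h) (simp add: bridge_def)
    then show "\<bar>h (fst (vertex_point u)) * (real K / 2) - h (fst (vertex_point w)) * (real K / 2)\<bar> \<le> real K"
      using mult_right_mono[of "\<bar>h (fst u) - h (fst w)\<bar>" 2 "real K / 2"]
      by (simp only: fst_conv scale) simp
  qed simp
  then have "\<bar>h (fst x) - h (fst y)\<bar> * (real K / 2) \<le> qdist x y"
    by (simp only: scale)
  moreover have "\<bar>h (fst x) - h (fst y)\<bar> * (1 / 2) \<le> \<bar>h (fst x) - h (fst y)\<bar> * (real K / 2)"
    using K_pos by (intro mult_left_mono) auto
  ultimately have "\<bar>h (fst x) - h (fst y)\<bar> * (1 / 2) \<le> qdist x y"
    by (rule order_trans[rotated])
  then show ?thesis
    by simp
qed

lemma card_separators_lipschitz: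
  assumes "U \<in> \<M>" "x \<in> disjoint_union \<Y>" "y \<in> disjoint_union \<Y>"
  shows "\<bar>real (card (separators (fst x) U)) - real (card (separators (fst y) U))\<bar> \<le> 2 * qdist x y"
proof (rule adjacent_lipschitz[OF _ assms(2,3)])
  fix X X' assume "proj_complex_adj \<Y> K X X'"
  then show "\<bar>real (card (separators X U)) - real (card (separators X' U))\<bar> \<le> 2"
    using card_separators_adjacent[of X X' U] card_separators_adjacent[of X' X U] assms(1)
    by (simp add: proj_complex_adj_commute[of X'] abs_le_iff flip: of_nat_diff)
qed

text \<open>A separator can disappear in passing to a neighbour only when its position is below 2.
  Its position, set to 0 once it no longer separates, therefore drops by at most 2 per bridge and
  cannot reach 0 from a value above \<open>2 * qdist x y\<close>.\<close>

lemma separators_stable: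
  assumes x: "x \<in> disjoint_union \<Y>" and y: "y \<in> disjoint_union \<Y>" and Z: "Z \<in> \<M>"
    and W: "W \<in> separators (fst x) Z" and far: "2 * qdist x y < real (card (separators (fst x) W))"
  shows "W \<in> separators (fst y) Z"
proof (rule ccontr)
  assume not: "W \<notin> separators (fst y) Z"
  define h where "h X = (if W \<in> separators X Z then real (card (separators X W)) else 0)" for X
  have WM: "W \<in> \<M>"
    using W by (simp add: separators_def)
  have le: "h X \<le> h X' + 2" if adj: "proj_complex_adj \<Y> K X X'" for X X'
  proof (cases "W \<in> separators X Z \<and> 2 \<le> card (separators X W)")
    case True
    then have "W \<in> separators X' Z"
      using separators_adjacent[OF adj _ Z] by blast
    then show ?thesis
      using True card_separators_adjacent[OF adj WM] by (simp add: h_def)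
  next
    case False
    then show ?thesis
      by (auto simp: h_def)
  qed
  have "\<bar>h (fst x) - h (fst y)\<bar> \<le> 2 * qdist x y"
  proof (rule adjacent_lipschitz[OF _ x y])
    fix X X' assume "proj_complex_adj \<Y> K X X'"
    then show "\<bar>h X - h X'\<bar> \<le> 2"
      using le[of X X'] le[of X' X] by (simp add: proj_complex_adj_commute[of X'] abs_le_iff)
  qed
  then show False
    using W not far by (simp add: h_def)
qed

end

section \<open>The action on the quasi-tree\<close>

text \<open>Bijectivity comes from the inverse element; extensionality is required because the
  action is a homomorphism into \<open>BijGroup\<close>, whose elements are extensional
  maps.\<close>

lemma group_actionI:
  fixes G (structure)
  assumes "group G"
    and ext: "\<And>g. g \<in> carrier G \<Longrightarrow> \<psi> g \<in> extensional E"
    and closed: "\<And>g x. \<lbrakk>g \<in> carrier G; x \<in> E\<rbrakk> \<Longrightarrow> \<psi> g x \<in> E"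
    and one: "\<And>x. x \<in> E \<Longrightarrow> \<psi> \<one> x = x"
    and mult: "\<And>g h x. \<lbrakk>g \<in> carrier G; h \<in> carrier G; x \<in> E\<rbrakk> \<Longrightarrow> \<psi> (g \<otimes> h) x = \<psi> g (\<psi> h x)"
  shows "group_action G E \<psi>"
proof -
  interpret group G
    by fact
  have inverse: "\<psi> (inv g) (\<psi> g x) = x" "\<psi> g (\<psi> (inv g) x) = x" if "g \<in> carrier G" "x \<in> E" for g x
    using that mult[of "inv g" g x] mult[of g "inv g" x] one by simp_all
  have Bij: "\<psi> g \<in> Bij E" if g: "g \<in> carrier G" for g
    unfolding Bij_def using g ext inverse closed
    by (auto intro!: bij_betw_byWitness[where f' = "\<psi> (inv g)"])
  have "\<psi> \<in> hom G (BijGroup E)"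
  proof (rule homI)
    fix g h assume g: "g \<in> carrier G" and h: "h \<in> carrier G"
    have "\<psi> (g \<otimes> h) = compose E (\<psi> g) (\<psi> h)"
      using g h mult ext by (intro extensionalityI[of _ E]) (auto simp: compose_def)
    then show "\<psi> (g \<otimes> h) = \<psi> g \<otimes>\<^bsub>BijGroup E\<^esub> \<psi> h"
      using Bij g h by (simp add: BijGroup_def)
  qed (simp add: BijGroup_def Bij)
  then show ?thesis
    by (intro group_action.intro group_hom.intro group_hom_axioms.intro group_BijGroup is_group)
qed

lemma diam_image_isometry:
  assumes "\<And>a b. \<lbrakk>a \<in> S; b \<in> S\<rbrakk> \<Longrightarrow> d' (f a) (f b) = d a b"
  shows "diam d' (f ` S) = diam d S"
  using assms by (auto simp: diam_def image_image intro!: SUP_cong)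

locale quasi_tree_action = quasi_tree_of_spaces \<Y> \<theta> K + group G + projection_family_action G \<Y> \<alpha> \<phi>
  for G :: "('g, 'm) monoid_scheme" (structure) and \<Y> :: "('i, 'v, 'e) graph_family"
    and \<alpha> :: "'g \<Rightarrow> 'i \<Rightarrow> 'i" and \<phi> :: "'g \<Rightarrow> 'i \<times> ('v, 'e) point \<Rightarrow> 'i \<times> ('v, 'e) point"
    and \<theta> K :: nat
begin

sublocale mem: group_action G "members \<Y>" \<alpha>
  by (rule members_action)

sublocale pts: group_action G "disjoint_union \<Y>" \<phi>
  by (rule points_action)

lemma fst_action: "\<lbrakk>g \<in> carrier G; x \<in> disjoint_union \<Y>\<rbrakk> \<Longrightarrow> fst (\<phi> g x) = \<alpha> g (fst x)"
  using permutes_members[of g "fst x" "snd x"] by simp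

lemma action_in_union: "\<lbrakk>g \<in> carrier G; x \<in> disjoint_union \<Y>\<rbrakk> \<Longrightarrow> \<phi> g x \<in> disjoint_union \<Y>"
  by (rule pts.element_image) auto

lemma action_in_members: "\<lbrakk>g \<in> carrier G; Y \<in> \<M>\<rbrakk> \<Longrightarrow> \<alpha> g Y \<in> \<M>"
  by (rule mem.element_image) auto

lemma members_inj: "\<lbrakk>g \<in> carrier G; X \<in> \<M>; Y \<in> \<M>\<rbrakk> \<Longrightarrow> \<alpha> g X = \<alpha> g Y \<longleftrightarrow> X = Y"
  using mem.inj_prop[of g] by (auto dest: inj_onD)

lemma point_proj_action:
  assumes g: "g \<in> carrier G" and U: "U \<in> \<M>" and x: "x \<in> disjoint_union \<Y>"
  shows "point_proj (\<alpha> g U) (\<phi> g x) = (\<lambda>p. snd (\<phi> g (U, p))) ` point_proj U x"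
proof (cases "fst x = U")
  case True
  then show ?thesis
    using fst_action[OF g x] by (auto simp: point_proj_def)
next
  case False
  have X: "fst x \<in> \<M>"
    using x by (simp add: disjoint_union_iff)
  have "Vertex ` proj \<Y> (\<alpha> g U) (\<alpha> g (fst x))
      = snd ` (\<lambda>p. (\<alpha> g U, Vertex p)) ` proj \<Y> (\<alpha> g U) (\<alpha> g (fst x))"
    by (simp add: image_image)
  also have "\<dots> = snd ` (\<lambda>p. \<phi> g (U, Vertex p)) ` proj \<Y> U (fst x)"
    using equivariant[OF g U X] False by simp
  finally show ?thesis
    using False members_inj[OF g X U] fst_action[OF g x] by (simp add: point_proj_def image_image)
qed

lemma pdist_action:
  assumes g: "g \<in> carrier G" and U: "U \<in> \<M>" and x: "x \<in> disjoint_union \<Y>"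
    and z: "z \<in> disjoint_union \<Y>"
  shows "pdist (\<alpha> g U) (\<phi> g x) (\<phi> g z) = pdist U x z"
proof -
  have "pdist (\<alpha> g U) (\<phi> g x) (\<phi> g z) = diam (path_dist (graph \<Y> (\<alpha> g U)))
      ((\<lambda>p. snd (\<phi> g (U, p))) ` (point_proj U x \<union> point_proj U z))"
    by (simp add: pdist_def point_proj_action g U x z image_Un)
  also have "\<dots> = pdist U x z"
    unfolding pdist_def
    using point_proj_subset[OF U x] point_proj_subset[OF U z] U
    by (intro diam_image_isometry isometric g) (auto simp: disjoint_union_iff)
  finally show ?thesis .
qed

lemma proj_dist_action:
  assumes g: "g \<in> carrier G" and "U \<in> \<M>" "X \<in> \<M>" "Z \<in> \<M>" "X \<noteq> U" "Z \<noteq> U"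
  shows "proj_dist \<Y> (\<alpha> g U) (\<alpha> g X) (\<alpha> g Z) = proj_dist \<Y> U X Z"
proof -
  obtain p q where "(X, p) \<in> disjoint_union \<Y>" "(Z, q) \<in> disjoint_union \<Y>"
    using assms obtain_point by metis
  then show ?thesis
    using pdist_action[of g U "(X, p)" "(Z, q)"] assms
    by (simp add: pdist_eq_proj_dist fst_action members_inj)
qed

lemma separators_action:
  assumes g: "g \<in> carrier G" and X: "X \<in> \<M>" and Z: "Z \<in> \<M>"
  shows "separators (\<alpha> g X) (\<alpha> g Z) = \<alpha> g ` separators X Z"
proof -
  have "\<alpha> g U \<in> separators (\<alpha> g X) (\<alpha> g Z) \<longleftrightarrow> U \<in> separators X Z" if "U \<in> \<M>" for U
    using that proj_dist_action[OF g that X Z] g X Z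
    by (auto simp: separators_def action_in_members members_inj)
  moreover have "separators (\<alpha> g X) (\<alpha> g Z) \<subseteq> \<alpha> g ` \<M>"
    using mem.surj_prop[OF g] by (auto simp: separators_def)
  moreover have "separators X Z \<subseteq> \<M>"
    by (auto simp: separators_def)
  ultimately show ?thesis
    by blast
qed

lemma card_separators_action:
  assumes "g \<in> carrier G" "X \<in> \<M>" "Z \<in> \<M>"
  shows "card (separators (\<alpha> g X) (\<alpha> g Z)) = card (separators X Z)"
  unfolding separators_action[OF assms]
  by (intro card_image inj_on_subset[OF mem.inj_prop[OF assms(1)]]) (auto simp: separators_def)

lemma vertex_point_action:
  assumes g: "g \<in> carrier G" and b: "bridge u w"
  shows "\<phi> g (vertex_point u) = vertex_point (vertex_image \<phi> g u)"
    and "fst (vertex_image \<phi> g u) = \<alpha> g (fst u)"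
    and "snd (vertex_image \<phi> g u) \<in> proj \<Y> (\<alpha> g (fst u)) (\<alpha> g (fst w))"
proof -
  have mem: "fst u \<in> \<M>" "fst w \<in> \<M>" "fst u \<noteq> fst w" "snd u \<in> proj \<Y> (fst u) (fst w)"
    using b by (auto simp: bridge_def adjacent_iff)
  have "\<phi> g (vertex_point u) \<in> (\<lambda>p. \<phi> g (fst u, Vertex p)) ` proj \<Y> (fst u) (fst w)"
    using mem by blast
  then obtain q where q: "q \<in> proj \<Y> (\<alpha> g (fst u)) (\<alpha> g (fst w))"
    "\<phi> g (vertex_point u) = (\<alpha> g (fst u), Vertex q)"
    unfolding equivariant[OF g mem(1-3), symmetric] by blast
  then have "vertex_image \<phi> g u = (\<alpha> g (fst u), q)"
    unfolding vertex_image_def by (intro the_equality) (auto simp: prod_eq_iff)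
  then show "\<phi> g (vertex_point u) = vertex_point (vertex_image \<phi> g u)"
    "fst (vertex_image \<phi> g u) = \<alpha> g (fst u)"
    "snd (vertex_image \<phi> g u) \<in> proj \<Y> (\<alpha> g (fst u)) (\<alpha> g (fst w))"
    using q by auto
qed

lemma bridge_action:
  assumes g: "g \<in> carrier G" and b: "bridge u w"
  shows "bridge (vertex_image \<phi> g u) (vertex_image \<phi> g w)"
proof -
  have b': "bridge w u"
    using b by (simp add: bridge_commute)
  have mem: "fst u \<in> \<M>" "fst w \<in> \<M>" "fst u \<noteq> fst w" "separators (fst u) (fst w) = {}"
    using b by (auto simp: bridge_def adjacent_iff)
  show ?thesis
    using vertex_point_action[OF g b] vertex_point_action[OF g b'] mem g
    by (simp add: bridge_def adjacent_iff action_in_members members_inj separators_action)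
qed

section \<open>The induced action on the realization of the quasi-tree\<close>

lemma inj_on_qt_incl: "inj_on qt_incl (disjoint_union \<Y>)"
proof (rule inj_onI)
  \<comment> \<open>The member index is read off from a description of an interior point, so at
    least one must exist: \<open>qt_incl\<close> would forget the index on
    \<open>Interior {}\<close>.\<close>
  have nonempty: "S \<noteq> {}" if "(Y, Interior S) \<in> disjoint_union \<Y>" for Y S
    using that by (auto simp: disjoint_union_def realization_def edge_point_def split: if_splits)
  fix x y assume x: "x \<in> disjoint_union \<Y>" and y: "y \<in> disjoint_union \<Y>" and eq: "qt_incl x = qt_incl y"
  obtain Y p Z q where xy: "x = (Y, p)" "y = (Z, q)"
    by (cases x; cases y)
  show "x = y"
  proof (cases p)
    case (Vertex v)
    then show ?thesis
      using xy eq by (cases q) auto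
  next
    case p: (Interior S)
    then obtain T where q: "q = Interior T"
      using xy eq by (cases q) auto
    have img: "((\<lambda>(a, t). (Old (Y, a), t)) ` S :: (('i \<times> 'e, 'i \<times> 'v) qt_arc \<times> real) set)
        = (\<lambda>(a, t). (Old (Z, a), t)) ` T"
      using eq by (simp add: xy p q)
    obtain a t where "(a, t) \<in> S"
      using nonempty x by (fastforce simp: xy p)
    then have "(Old (Y, a) :: ('i \<times> 'e, 'i \<times> 'v) qt_arc, t) \<in> (\<lambda>(a, t). (Old (Z, a), t)) ` T"
      unfolding img[symmetric] by force
    then have "Y = Z"
      by auto
    moreover have "inj (\<lambda>(a, t). (Old (Y, a) :: ('i \<times> 'e, 'i \<times> 'v) qt_arc, t :: real))"
      by (auto simp: inj_def)
    ultimately show ?thesis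
      using img by (simp add: xy p q inj_image_eq_iff)
  qed
qed

abbreviation "\<psi> \<equiv> qt_action \<Y> K \<phi>"

lemma qt_action_incl: "x \<in> disjoint_union \<Y> \<Longrightarrow> \<psi> g (qt_incl x) = qt_incl (\<phi> g x)"
  by (simp add: qt_action_def qt_incl_in_realization inv_into_f_f[OF inj_on_qt_incl])

lemma qt_action_bridge:
  assumes g: "g \<in> carrier G" and b: "bridge u w" and t: "0 \<le> t" "t \<le> real K"
  shows "\<psi> g (edge_point QT (Bridge u w) t)
    = edge_point QT (Bridge (vertex_image \<phi> g u) (vertex_image \<phi> g w)) t"
proof -
  have b': "bridge w u"
    using b by (simp add: bridge_commute)
  have vertex: "\<psi> g (Vertex u) = Vertex (vertex_image \<phi> g u)" if b: "bridge u w" for u w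
    using qt_action_incl[OF bridge_vertex_point(1)[OF b], of g] vertex_point_action(1)[OF g b] by simp
  consider "t = 0" | "t = real K" | "0 < t" "t < real K"
    using t by linarith
  then show ?thesis
  proof cases
    case 1
    then show ?thesis
      using vertex[OF b] by simp
  next
    case 2
    then show ?thesis
      using vertex[OF b'] K_pos by (simp add: edge_point_def)
  next
    case 3
    have S: "edge_point QT (Bridge u w) t = Interior {(Bridge u w, t), (Bridge w u, real K - t)}"
      if "bridge u w" for u w
      using 3 that by (simp add: edge_point_def qt_reversal_Bridge)
    \<comment> \<open>Interior points in the image of \<open>qt_incl\<close> are described by
      \<open>Old\<close> arcs only, so inside a bridge \<open>qt_action\<close> uses its linear
      extension.\<close>
    have "Interior {(Bridge u w, t), (Bridge w u, real K - t)} \<noteq> qt_incl x" for x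
    proof (cases x)
      case (Pair Y p)
      then show ?thesis
        by (cases p) auto
    qed
    then have "edge_point QT (Bridge u w) t \<notin> qt_incl ` disjoint_union \<Y>"
      unfolding S[OF b] by blast
    moreover have "edge_point QT (Bridge u w) t \<in> realization QT"
      using b t by (intro edge_point_in_realization) auto
    ultimately show ?thesis
      by (simp add: qt_action_def S b bridge_action[OF g b])
  qed
qed

lemma qt_action_closed:
  assumes "g \<in> carrier G" "z \<in> realization QT"
  shows "\<psi> g z \<in> realization QT"
  using assms(2)
proof (cases rule: qt_realization_cases)
  case (incl x)
  then show ?thesis
    using assms by (simp add: qt_action_incl qt_incl_in_realization action_in_union)
next
  case (bridge u w t)
  then show ?thesis
    using assms by (simp add: qt_action_bridge bridge_action edge_point_in_realization)
qed

lemma vertex_image_mult: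
  assumes g: "g \<in> carrier G" and h: "h \<in> carrier G" and b: "bridge u w"
  shows "vertex_image \<phi> (g \<otimes> h) u = vertex_image \<phi> g (vertex_image \<phi> h u)"
proof -
  have "\<phi> (g \<otimes> h) (vertex_point u) = \<phi> g (\<phi> h (vertex_point u))"
    using g h by (intro pts.composition_rule bridge_vertex_point(1)[OF b])
  then have "vertex_point (vertex_image \<phi> (g \<otimes> h) u)
      = vertex_point (vertex_image \<phi> g (vertex_image \<phi> h u))"
    using vertex_point_action(1)[OF m_closed[OF g h] b] vertex_point_action(1)[OF h b]
      vertex_point_action(1)[OF g bridge_action[OF h b]] by simp
  then show ?thesis
    by (simp add: prod_eq_iff)
qed

lemma vertex_image_one:
  assumes b: "bridge u w"
  shows "vertex_image \<phi> \<one> u = u"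
proof -
  have "\<phi> \<one> (vertex_point u) = vertex_point u"
    using bridge_vertex_point(1)[OF b] pts.id_eq_one by (metis restrict_apply')
  then show ?thesis
    using vertex_point_action(1)[OF one_closed b] by (simp add: prod_eq_iff)
qed

lemma qt_group_action: "group_action G (realization QT) \<psi>"
proof (rule group_actionI)
  show "group G"
    by (rule is_group)
  show "\<psi> g \<in> extensional (realization QT)" for g
    by (simp add: qt_action_def)
  show "\<psi> g z \<in> realization QT" if "g \<in> carrier G" "z \<in> realization QT" for g z
    using that by (rule qt_action_closed)
  show "\<psi> \<one> z = z" if "z \<in> realization QT" for z
    using that
  proof (cases rule: qt_realization_cases)
    case (incl x)
    then show ?thesis
      using pts.id_eq_one by (metis qt_action_incl restrict_apply')
  next
    case (bridge u w t)
    then have "bridge w u"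
      by (simp add: bridge_commute)
    then show ?thesis
      using bridge by (simp add: qt_action_bridge vertex_image_one)
  qed
  show "\<psi> (g \<otimes> h) z = \<psi> g (\<psi> h z)"
    if g: "g \<in> carrier G" and h: "h \<in> carrier G" and z: "z \<in> realization QT" for g h z
    using z
  proof (cases rule: qt_realization_cases)
    case (incl x)
    then show ?thesis
      using g h by (simp add: qt_action_incl action_in_union pts.composition_rule)
  next
    case (bridge u w t)
    then have "bridge w u"
      by (simp add: bridge_commute)
    then show ?thesis
      using bridge g h by (simp add: qt_action_bridge vertex_image_mult bridge_action)
  qed
qed

sublocale qt: group_action G "realization QT" \<psi>
  by (rule qt_group_action)

text \<open>An edge of a member may be carried to a set that is not an edge, but two of its points
  keep their distance within the image member, and the inclusion into the quasi-tree does not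
  increase it. \<open>lipschitz_path_dist\<close> is then applied to the distance of the image from
  the fixed point \<open>\<psi> g y\<close>.\<close>

lemma qt_action_nonexpanding:
  assumes g: "g \<in> carrier G" and y: "y \<in> realization QT" and z: "z \<in> realization QT"
  shows "path_dist QT (\<psi> g y) (\<psi> g z) \<le> path_dist QT y z"
proof -
  have edge: "path_dist QT (\<psi> g (edge_point QT b s)) (\<psi> g (edge_point QT b t)) \<le> \<bar>s - t\<bar>"
    if b: "b \<in> arcs (digraph QT)" and s: "s \<in> {0..len QT b}" and t: "t \<in> {0..len QT b}" for b s t
    using b
  proof (cases rule: qt_arc_cases)
    case (Old Y a)
    let ?p = "\<lambda>t. (Y, edge_point (graph \<Y> Y) a t)"
    have p: "?p s \<in> disjoint_union \<Y>" "?p t \<in> disjoint_union \<Y>"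
      using Old s t by (auto simp: disjoint_union_iff edge_point_in_realization)
    have eq: "\<phi> g (?p s) = (\<alpha> g Y, snd (\<phi> g (?p s)))" "\<phi> g (?p t) = (\<alpha> g Y, snd (\<phi> g (?p t)))"
      using fst_action[OF g p(1)] fst_action[OF g p(2)] by (simp_all add: prod_eq_iff)
    have "path_dist QT (\<psi> g (edge_point QT b s)) (\<psi> g (edge_point QT b t)) = qdist (\<phi> g (?p s)) (\<phi> g (?p t))"
      using Old p by (simp add: qt_incl_edge_point qt_action_incl)
    also have "\<dots> \<le> path_dist (graph \<Y> (\<alpha> g Y)) (snd (\<phi> g (?p s))) (snd (\<phi> g (?p t)))"
      using path_dist_qt_incl[of "\<alpha> g Y" "snd (\<phi> g (?p s))" "snd (\<phi> g (?p t))"]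
        action_in_union[OF g p(1)] action_in_union[OF g p(2)] eq by metis
    also have "\<dots> = path_dist (graph \<Y> Y) (edge_point (graph \<Y> Y) a s) (edge_point (graph \<Y> Y) a t)"
      using p by (intro isometric g)
    also have "\<dots> \<le> \<bar>s - t\<bar>"
      using Old s t by (intro path_dist_edge) auto
    finally show ?thesis .
  next
    case (Bridge u w)
    then have "Bridge (vertex_image \<phi> g u) (vertex_image \<phi> g w) \<in> arcs (digraph QT)"
      using bridge_action[OF g] by simp
    then show ?thesis
      using Bridge s t path_dist_edge[of "Bridge (vertex_image \<phi> g u) (vertex_image \<phi> g w)" QT s t]
      by (simp add: qt_action_bridge[OF g])
  qed
  have "\<bar>path_dist QT (\<psi> g y) (\<psi> g y) - path_dist QT (\<psi> g y) (\<psi> g z)\<bar> \<le> path_dist QT y z"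
  proof (rule QT.lipschitz_path_dist[OF _ y z])
    fix b s t assume *: "b \<in> arcs (digraph QT)" "s \<in> {0..len QT b}" "t \<in> {0..len QT b}"
    have "\<bar>path_dist QT (\<psi> g y) (\<psi> g (edge_point QT b s)) - path_dist QT (\<psi> g y) (\<psi> g (edge_point QT b t))\<bar>
        \<le> path_dist QT (\<psi> g (edge_point QT b s)) (\<psi> g (edge_point QT b t))"
      using * by (intro QT.path_dist_triangle_abs qt_action_closed g y edge_point_in_realization) auto
    also have "\<dots> \<le> \<bar>s - t\<bar>"
      using * by (rule edge)
    finally show "\<bar>path_dist QT (\<psi> g y) (\<psi> g (edge_point QT b s))
        - path_dist QT (\<psi> g y) (\<psi> g (edge_point QT b t))\<bar> \<le> \<bar>s - t\<bar>" .
  qed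
  then show ?thesis
    using qt_action_closed[OF g y] by simp
qed

lemma qt_action_isometry:
  assumes g: "g \<in> carrier G" and y: "y \<in> realization QT" and z: "z \<in> realization QT"
  shows "path_dist QT (\<psi> g y) (\<psi> g z) = path_dist QT y z"
proof -
  have "\<psi> (inv g) (\<psi> g v) = v" if v: "v \<in> realization QT" for v
    using qt.composition_rule[OF v inv_closed[OF g] g] qt.id_eq_one v g by (metis l_inv restrict_apply')
  then have "path_dist QT y z \<le> path_dist QT (\<psi> g y) (\<psi> g z)"
    using qt_action_nonexpanding[OF inv_closed[OF g] qt_action_closed[OF g y] qt_action_closed[OF g z]] y z
    by simp
  then show ?thesis
    using qt_action_nonexpanding[OF assms] by simp
qed

lemma isometric_action_qt: "isometric_action G (realization QT) (path_dist QT) \<psi>"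
  by (intro isometric_action.intro isometric_action_axioms.intro QT.Metric_space_path_dist
      qt_group_action qt_action_isometry)

end

section \<open>Acylindricity\<close>

lemma finite_card_fibres:
  assumes T: "f ` H \<subseteq> T" "finite T" "card T \<le> m"
    and fibre: "\<And>t. t \<in> T \<Longrightarrow> finite {h \<in> H. f h = t} \<and> card {h \<in> H. f h = t} \<le> b"
  shows "finite H \<and> card H \<le> m * b"
proof -
  have H: "H = (\<Union>t\<in>T. {h \<in> H. f h = t})"
    using T(1) by auto
  have "card (\<Union>t\<in>T. {h \<in> H. f h = t}) \<le> (\<Sum>t\<in>T. card {h \<in> H. f h = t})"
    using T(2) by (rule card_UN_le)
  also have "\<dots> \<le> card T * b"
    using fibre by (intro sum_bounded_above[where K = b, simplified]) auto
  also have "\<dots> \<le> m * b"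
    using T(3) by simp
  finally have "card H \<le> m * b"
    using H by simp
  moreover have "finite (\<Union>t\<in>T. {h \<in> H. f h = t})"
    using fibre T(2) by blast
  ultimately show ?thesis
    using H by simp
qed

context group
begin

text \<open>Left translation by the inverse of one fixed element of \<open>F\<close> embeds
  \<open>F\<close> into \<open>S\<close>.\<close>

lemma finite_card_coset:
  assumes F: "F \<subseteq> carrier G" and S: "finite S" "card S \<le> b"
    and quot: "\<And>g h. \<lbrakk>g \<in> F; h \<in> F\<rbrakk> \<Longrightarrow> inv g \<otimes> h \<in> S"
  shows "finite F \<and> card F \<le> b"
proof (cases "F = {}")
  case False
  then obtain g where g: "g \<in> F"
    by blast
  have inj: "inj_on (\<lambda>h. inv g \<otimes> h) F"
    using F g by (intro inj_onI) (metis inv_closed Units_eq Units_l_cancel subsetD)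
  have image: "(\<lambda>h. inv g \<otimes> h) ` F \<subseteq> S"
    using quot[OF g] by blast
  show ?thesis
    using inj_on_finite[OF inj image S(1)] card_inj_on_le[OF inj image S(1)] S(2) by simp
qed simp

end

context quasi_tree_action
begin

section \<open>Counting the possible images of a member\<close>

definition movers :: "real \<Rightarrow> 'i \<times> ('v, 'e) point \<Rightarrow> 'i \<times> ('v, 'e) point \<Rightarrow> 'g set" where
  "movers D x y = {h \<in> carrier G. qdist x (\<phi> h x) \<le> D \<and> qdist y (\<phi> h y) \<le> D}"

text \<open>Meant to contain every possible value of \<open>\<alpha> h W\<close>: a mover should
  keep the projection distance large, and it shifts the position by at most
  \<open>2 * D\<close>.\<close>

definition window :: "real \<Rightarrow> 'i \<times> ('v, 'e) point \<Rightarrow> 'i \<times> ('v, 'e) point \<Rightarrow> 'i \<Rightarrow> 'i set" where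
  "window D x y W = {U \<in> \<M>. of_nat K < pdist U x y \<and>
     \<bar>real (card (separators (fst x) U)) - real (card (separators (fst x) W))\<bar> \<le> 2 * D}"

text \<open>There are at most \<open>2 * nat \<lceil>2 * D\<rceil> + 1\<close> positions within
  \<open>2 * D\<close> of a given one; the remaining 1 accounts for \<open>fst x\<close>, which is
  excluded from the injectivity of positions.\<close>

definition window_card :: "real \<Rightarrow> nat" where
  "window_card D = 2 * nat \<lceil>2 * D\<rceil> + 2"

lemma finite_card_window:
  assumes x: "x \<in> disjoint_union \<Y>" and y: "y \<in> disjoint_union \<Y>"
  shows "finite (window D x y W)" "card (window D x y W) \<le> window_card D"
proof -
  define a where "a = card (separators (fst x) W)"
  define m where "m = nat \<lceil>2 * D\<rceil>"
  have m: "2 * D \<le> real m"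
    unfolding m_def by linarith
  let ?f = "\<lambda>U. card (separators (fst x) U)"
  have inj: "inj_on ?f (window D x y W - {fst x})"
    using inj_on_card_separators_points[OF x y] by (rule inj_on_subset) (auto simp: window_def)
  have image: "?f ` (window D x y W - {fst x}) \<subseteq> {a - m..a + m}"
  proof (rule image_subsetI)
    fix U assume "U \<in> window D x y W - {fst x}"
    then have "\<bar>real (?f U) - real a\<bar> \<le> real m"
      using m by (simp add: window_def a_def)
    then have "real a \<le> real (?f U + m)" "real (?f U) \<le> real (a + m)"
      by simp_all
    then show "?f U \<in> {a - m..a + m}"
      by (simp only: of_nat_le_iff) auto
  qed
  have "finite (window D x y W - {fst x})"
    using inj image by (rule inj_on_finite) simp
  then show "finite (window D x y W)"
    by simp
  have "card (window D x y W - {fst x}) \<le> 2 * m + 1"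
    using card_inj_on_le[OF inj image] by simp
  then show "card (window D x y W) \<le> window_card D"
    using card_Diff1_le[of "window D x y W" "fst x"] card_Diff_singleton_if[of "window D x y W" "fst x"]
    by (simp add: window_card_def m_def split: if_splits)
qed

lemma qdist_action:
  assumes "g \<in> carrier G" "x \<in> disjoint_union \<Y>" "y \<in> disjoint_union \<Y>"
  shows "qdist (\<phi> g x) (\<phi> g y) = qdist x y"
  using qt_action_isometry[of g "qt_incl x" "qt_incl y"] assms
  by (simp add: qt_action_incl qt_incl_in_realization)

lemma qdist_commute: "qdist x y = qdist y x"
  by (rule path_dist_commute)

text \<open>Seen from \<open>\<phi> h x\<close>, the image of \<open>W\<close> has the position that
  \<open>W\<close> has from \<open>x\<close>; changing the base point by a distance \<open>D\<close>
  costs \<open>2 * D\<close>.\<close>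

lemma card_separators_mover:
  assumes x: "x \<in> disjoint_union \<Y>" and W: "W \<in> \<M>" and h: "h \<in> movers D x y"
  shows "\<bar>real (card (separators (fst x) (\<alpha> h W))) - real (card (separators (fst x) W))\<bar> \<le> 2 * D"
proof -
  have hG: "h \<in> carrier G" and hx: "qdist x (\<phi> h x) \<le> D"
    using h by (auto simp: movers_def)
  have "card (separators (fst (\<phi> h x)) (\<alpha> h W)) = card (separators (fst x) W)"
    using card_separators_action[OF hG _ W, of "fst x"] fst_action[OF hG x] x
    by (simp add: disjoint_union_iff)
  then show ?thesis
    using card_separators_lipschitz[OF action_in_members[OF hG W] x action_in_union[OF hG x]] hx by simp
qed

text \<open>The threshold is \<open>K\<close> plus \<open>D + 2 * \<theta>\<close> at each end, the
  cost at \<open>\<alpha> h W\<close> of replacing \<open>\<phi> h x\<close> by \<open>x\<close> and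
  \<open>\<phi> h y\<close> by \<open>y\<close>.\<close>

lemma far_in_window:
  assumes x: "x \<in> disjoint_union \<Y>" and y: "y \<in> disjoint_union \<Y>" and W: "W \<in> \<M>"
    and D: "0 \<le> D" and far: "ennreal (real K + 2 * (D + 2 * real \<theta>)) < pdist W x y"
    and h: "h \<in> movers D x y"
  shows "\<alpha> h W \<in> window D x y W"
proof -
  have hG: "h \<in> carrier G" and hx: "qdist x (\<phi> h x) \<le> D" and hy: "qdist y (\<phi> h y) \<le> D"
    using h by (auto simp: movers_def)
  let ?U = "\<alpha> h W"
  note U = action_in_members[OF hG W]
  note x' = action_in_union[OF hG x] and y' = action_in_union[OF hG y]
  have "of_nat K < pdist ?U x y"
  proof (rule ccontr)
    assume "\<not> ?thesis"
    then have K: "pdist ?U x y \<le> ennreal (real K)"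
      by (simp add: ennreal_of_nat_eq_real_of_nat)
    have hx': "pdist ?U (\<phi> h x) x \<le> ennreal (D + 2 * real \<theta>)"
      using pdist_le_qdist[OF U x' x] hx
      by (elim order_trans) (intro ennreal_leI, simp add: qdist_commute)
    have hy': "pdist ?U y (\<phi> h y) \<le> ennreal (D + 2 * real \<theta>)"
      using pdist_le_qdist[OF U y y'] hy by (elim order_trans) (intro ennreal_leI, simp)
    have "pdist W x y = pdist ?U (\<phi> h x) (\<phi> h y)"
      by (simp add: pdist_action hG W x y)
    also have "\<dots> \<le> pdist ?U (\<phi> h x) x + pdist ?U x (\<phi> h y)"
      by (intro pdist_triangle U x x' y')
    also have "\<dots> \<le> pdist ?U (\<phi> h x) x + (pdist ?U x y + pdist ?U y (\<phi> h y))"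
      by (intro add_left_mono pdist_triangle U x y y')
    also have "\<dots> \<le> ennreal (D + 2 * real \<theta>) + (ennreal (real K) + ennreal (D + 2 * real \<theta>))"
      by (intro add_mono hx' hy' K)
    also have "\<dots> = ennreal (real K + 2 * (D + 2 * real \<theta>))"
      using D by (simp flip: ennreal_plus)
    finally show False
      using far by simp
  qed
  then show ?thesis
    using U card_separators_mover[OF x W h] by (simp add: window_def)
qed

lemma movers_inv_mult:
  assumes g: "g \<in> movers D x y" and h: "h \<in> movers D x y"
    and x: "x \<in> disjoint_union \<Y>" and y: "y \<in> disjoint_union \<Y>"
  shows "inv g \<otimes> h \<in> movers (2 * D) x y"
proof -
  have gG: "g \<in> carrier G" and hG: "h \<in> carrier G"
    using g h by (auto simp: movers_def)
  have "qdist x (\<phi> (inv g \<otimes> h) x) \<le> 2 * D"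
    if x: "x \<in> disjoint_union \<Y>" and d: "qdist x (\<phi> g x) \<le> D" "qdist x (\<phi> h x) \<le> D" for x
  proof -
    have "qdist x (\<phi> (inv g \<otimes> h) x) = qdist (\<phi> g x) (\<phi> g (\<phi> (inv g \<otimes> h) x))"
      using gG hG x by (simp add: qdist_action action_in_union)
    also have "\<phi> g (\<phi> (inv g \<otimes> h) x) = \<phi> h x"
      using gG hG x pts.composition_rule[of x g "inv g \<otimes> h"] by (simp add: inv_solve_left m_assoc[symmetric])
    also have "qdist (\<phi> g x) (\<phi> h x) \<le> qdist (\<phi> g x) x + qdist x (\<phi> h x)"
      by (intro qdist_triangle action_in_union gG hG x)
    also have "\<dots> \<le> 2 * D"
      using d by (simp add: qdist_commute)
    finally show ?thesis .
  qed
  then show ?thesis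
    using g h x y by (auto simp: movers_def)
qed

lemma action_inv_mult:
  assumes "g \<in> carrier G" "h \<in> carrier G" "W \<in> \<M>" "\<alpha> g W = \<alpha> h W"
  shows "\<alpha> (inv g \<otimes> h) W = W"
  using assms mem.composition_rule[of W "inv g" h] mem.orbit_sym_aux[of g W "\<alpha> h W"] by simp

text \<open>\<open>far\<close> adds up two thresholds: the first part puts all images of
  \<open>W\<close> into the window, and \<open>L + 2 * \<theta>\<close> keeps any points of the
  projections of \<open>x\<close> and \<open>y\<close> at distance at least \<open>L\<close>.
  Quotients of movers with the same image move \<open>x\<close> and \<open>y\<close> by at most
  \<open>2 * D\<close>, which becomes \<open>2 * D + 2 * \<theta>\<close> on the
  projections.\<close>

lemma large_projection_case:
  assumes x: "x \<in> disjoint_union \<Y>" and y: "y \<in> disjoint_union \<Y>" and W: "W \<in> \<M>"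
    and D: "0 \<le> D" and L: "0 \<le> L"
    and far: "ennreal (real K + 2 * (D + 2 * real \<theta>) + (L + 2 * real \<theta>)) < pdist W x y"
    and acyl: "\<And>a b. \<lbrakk>a \<in> realization (graph \<Y> W); b \<in> realization (graph \<Y> W);
        L \<le> path_dist (graph \<Y> W) a b\<rbrakk>
      \<Longrightarrow> finite {h \<in> stabilizer G \<alpha> W. path_dist (graph \<Y> W) a (snd (\<phi> h (W, a))) \<le> 2 * D + 2 * real \<theta> \<and>
            path_dist (graph \<Y> W) b (snd (\<phi> h (W, b))) \<le> 2 * D + 2 * real \<theta>}
        \<and> card {h \<in> stabilizer G \<alpha> W. path_dist (graph \<Y> W) a (snd (\<phi> h (W, a))) \<le> 2 * D + 2 * real \<theta> \<and>
            path_dist (graph \<Y> W) b (snd (\<phi> h (W, b))) \<le> 2 * D + 2 * real \<theta>} \<le> C"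
  shows "finite (movers D x y) \<and> card (movers D x y) \<le> window_card D * C"
proof -
  let ?d = "path_dist (graph \<Y> W)"
  interpret W: connected_metric_graph "graph \<Y> W"
    using W by (rule member_graph)
  obtain a b where a: "a \<in> point_proj W x" and b: "b \<in> point_proj W y"
    using point_proj_nonempty[OF W] x y by blast
  have real: "a \<in> realization (graph \<Y> W)" "b \<in> realization (graph \<Y> W)"
    using a b point_proj_subset[OF W] x y by blast+
  then have ab: "(W, a) \<in> disjoint_union \<Y>" "(W, b) \<in> disjoint_union \<Y>"
    using W by (auto simp: disjoint_union_iff)
  have near: "pdist W z (W, c) \<le> ennreal (real \<theta>)"
    if z: "z \<in> disjoint_union \<Y>" and c: "c \<in> point_proj W z" for z c
  proof -
    have "pdist W z (W, c) \<le> pdist W z z"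
      unfolding pdist_def diam_le_iff[of _ "_ \<union> point_proj W (W, c)"]
      using c by (intro ballI diam_upper) (auto simp: point_proj_def[of W "(W, c)"])
    then show ?thesis
      using pdist_self[OF W z] by (simp add: ennreal_of_nat_eq_real_of_nat)
  qed
  have "L \<le> ?d a b"
  proof (rule ccontr)
    assume "\<not> ?thesis"
    then have "pdist W (W, a) (W, b) \<le> ennreal L"
      using real L path_dist_commute[of "graph \<Y> W" a b]
      by (auto simp: pdist_def point_proj_def diam_le_iff intro!: ennreal_leI)
    then have "pdist W (W, a) (W, b) + pdist W (W, b) y \<le> ennreal L + ennreal (real \<theta>)"
      using near[OF y b] by (intro add_mono) (simp_all add: pdist_commute)
    then have "pdist W (W, a) y \<le> ennreal L + ennreal (real \<theta>)"
      using pdist_triangle[OF W ab y] by (rule order_trans[rotated])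
    then have "pdist W x (W, a) + pdist W (W, a) y \<le> ennreal (real \<theta>) + (ennreal L + ennreal (real \<theta>))"
      using near[OF x a] by (intro add_mono)
    then have "pdist W x y \<le> ennreal (real \<theta>) + (ennreal L + ennreal (real \<theta>))"
      using pdist_triangle[OF W x ab(1) y] by (rule order_trans[rotated])
    also have "\<dots> \<le> ennreal (real K + 2 * (D + 2 * real \<theta>) + (L + 2 * real \<theta>))"
      using D L by (simp flip: ennreal_plus)
    finally show False
      using far by simp
  qed
  note acyl = acyl[OF real this]
  have in_window: "\<alpha> h W \<in> window D x y W" if h: "h \<in> movers D x y" for h
  proof (rule far_in_window[OF x y W D _ h])
    have "ennreal (real K + 2 * (D + 2 * real \<theta>)) \<le> ennreal (real K + 2 * (D + 2 * real \<theta>) + (L + 2 * real \<theta>))"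
      using L by (intro ennreal_leI) simp
    then show "ennreal (real K + 2 * (D + 2 * real \<theta>)) < pdist W x y"
      using far by (rule le_less_trans)
  qed
  \<comment> \<open>An element fixing \<open>W\<close> carries the projection of \<open>z\<close> to
    that of \<open>\<phi> k z\<close>, so the displacement of \<open>c\<close> is bounded by
    \<open>pdist W z (\<phi> k z)\<close>.\<close>
  have moved: "?d c (snd (\<phi> k (W, c))) \<le> 2 * D + 2 * real \<theta>"
    if k: "k \<in> carrier G" "\<alpha> k W = W" and z: "z \<in> disjoint_union \<Y>" "c \<in> point_proj W z"
      "qdist z (\<phi> k z) \<le> 2 * D" for k z c
  proof (rule path_dist_le_pdist)
    show "c \<in> point_proj W z"
      by fact
    show "snd (\<phi> k (W, c)) \<in> point_proj W (\<phi> k z)"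
      using point_proj_action[OF k(1) W z(1)] k(2) z(2) by auto
    show "pdist W z (\<phi> k z) \<le> ennreal (2 * D + 2 * real \<theta>)"
      using pdist_le_qdist[OF W z(1) action_in_union[OF k(1) z(1)]] z(3)
      by (elim order_trans) (intro ennreal_leI, simp)
    show "0 \<le> 2 * D + 2 * real \<theta>"
      using D by simp
  qed
  show ?thesis
  proof (rule finite_card_fibres)
    show "(\<lambda>h. \<alpha> h W) ` movers D x y \<subseteq> window D x y W"
      using in_window by blast
    fix U
    show "finite {h \<in> movers D x y. \<alpha> h W = U} \<and> card {h \<in> movers D x y. \<alpha> h W = U} \<le> C"
    proof (rule finite_card_coset)
      show "{h \<in> movers D x y. \<alpha> h W = U} \<subseteq> carrier G"
        by (auto simp: movers_def)
      fix g h assume g: "g \<in> {h \<in> movers D x y. \<alpha> h W = U}" and h: "h \<in> {h \<in> movers D x y. \<alpha> h W = U}"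
      let ?k = "inv g \<otimes> h"
      have k: "?k \<in> movers (2 * D) x y"
        using movers_inv_mult[of g D x y h] g h x y by simp
      then have kG: "?k \<in> carrier G"
        by (simp add: movers_def)
      have kW: "\<alpha> ?k W = W"
        using g h W by (intro action_inv_mult) (auto simp: movers_def)
      show "?k \<in> {h \<in> stabilizer G \<alpha> W. ?d a (snd (\<phi> h (W, a))) \<le> 2 * D + 2 * real \<theta> \<and>
          ?d b (snd (\<phi> h (W, b))) \<le> 2 * D + 2 * real \<theta>}"
        using k moved[OF kG kW x a] moved[OF kG kW y b] kG kW by (simp add: movers_def stabilizer_def)
    qed (use acyl in blast)+
  qed (rule finite_card_window[OF x y])+
qed

text \<open>The image of \<open>W\<close> separates the members of \<open>\<phi> h x\<close> and
  \<open>\<phi> h y\<close> with the original depths. The ends are then moved back one at a time by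
  \<open>separators_stable\<close>, each depth paying for its own end.\<close>

lemma separators_movers:
  assumes x: "x \<in> disjoint_union \<Y>" and y: "y \<in> disjoint_union \<Y>"
    and W: "W \<in> separators (fst x) (fst y)" and h: "h \<in> movers D x y"
    and deep: "2 * D < real (card (separators (fst x) W))" "2 * D < real (card (separators (fst y) W))"
  shows "\<alpha> h W \<in> separators (fst x) (fst y)"
proof -
  have hG: "h \<in> carrier G" and hx: "qdist (\<phi> h x) x \<le> D" and hy: "qdist (\<phi> h y) y \<le> D"
    using h by (auto simp: movers_def qdist_commute)
  have mem: "fst x \<in> \<M>" "fst y \<in> \<M>" "W \<in> \<M>"
    using x y W by (auto simp: disjoint_union_iff separators_def)
  note x' = action_in_union[OF hG x] and y' = action_in_union[OF hG y]
  have "\<alpha> h W \<in> separators (fst (\<phi> h x)) (fst (\<phi> h y))"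
    using W by (simp add: fst_action hG x y separators_action mem)
  moreover have "2 * qdist (\<phi> h x) x < real (card (separators (fst (\<phi> h x)) (\<alpha> h W)))"
    using hx deep(1) by (simp add: fst_action hG x card_separators_action mem)
  moreover have "fst (\<phi> h y) \<in> \<M>"
    using y' by (simp add: disjoint_union_iff)
  ultimately have "\<alpha> h W \<in> separators (fst x) (fst (\<phi> h y))"
    using separators_stable[OF x' x] by blast
  then have "\<alpha> h W \<in> separators (fst (\<phi> h y)) (fst x)"
    by (simp add: separators_commute)
  moreover have "2 * qdist (\<phi> h y) y < real (card (separators (fst (\<phi> h y)) (\<alpha> h W)))"
    using hy deep(2) by (simp add: fst_action hG y card_separators_action mem)
  ultimately have "\<alpha> h W \<in> separators (fst y) (fst x)"
    by (intro separators_stable[OF y' y mem(1)])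
  then show ?thesis
    by (simp add: separators_commute)
qed

text \<open>A mover is recorded by its restriction to \<open>S\<close>, an element of a product of
  \<open>card S\<close> windows; this is the origin of the power in the bound.\<close>

lemma many_separators_case:
  assumes x: "x \<in> disjoint_union \<Y>" and y: "y \<in> disjoint_union \<Y>"
    and S: "S \<subseteq> separators (fst x) (fst y)" "finite S"
    and deep: "\<And>W. W \<in> S \<Longrightarrow> 2 * D < real (card (separators (fst x) W))"
      "\<And>W. W \<in> S \<Longrightarrow> 2 * D < real (card (separators (fst y) W))"
    and stab: "finite {g \<in> carrier G. \<forall>Y\<in>S. \<alpha> g Y = Y}" "card {g \<in> carrier G. \<forall>Y\<in>S. \<alpha> g Y = Y} \<le> B"
  shows "finite (movers D x y) \<and> card (movers D x y) \<le> window_card D ^ card S * B"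
proof (rule finite_card_fibres)
  let ?T = "PiE S (window D x y)"
  have mem: "W \<in> \<M>" if "W \<in> S" for W
    using that S by (auto simp: separators_def)
  have "\<alpha> h W \<in> window D x y W" if h: "h \<in> movers D x y" and W: "W \<in> S" for h W
  proof -
    have U: "\<alpha> h W \<in> separators (fst x) (fst y)"
      using S W by (intro separators_movers[OF x y _ h] deep) auto
    then have "of_nat K < pdist (\<alpha> h W) x y"
      by (auto simp: separators_def pdist_eq_proj_dist)
    then show ?thesis
      using U card_separators_mover[OF x mem[OF W] h] by (simp add: window_def separators_def)
  qed
  then show "(\<lambda>h. restrict (\<alpha> h) S) ` movers D x y \<subseteq> ?T"
    by auto
  show "finite ?T"
    using S by (intro finite_PiE finite_card_window x y)
  have "card ?T = (\<Prod>W\<in>S. card (window D x y W))"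
    using S by (intro card_PiE)
  also have "\<dots> \<le> (\<Prod>W\<in>S. window_card D)"
    by (intro prod_mono) (simp add: finite_card_window x y)
  finally show "card ?T \<le> window_card D ^ card S"
    by simp
  fix u
  show "finite {h \<in> movers D x y. restrict (\<alpha> h) S = u}
      \<and> card {h \<in> movers D x y. restrict (\<alpha> h) S = u} \<le> B"
  proof (rule finite_card_coset[OF _ stab])
    show "{h \<in> movers D x y. restrict (\<alpha> h) S = u} \<subseteq> carrier G"
      by (auto simp: movers_def)
    fix g h assume g: "g \<in> {h \<in> movers D x y. restrict (\<alpha> h) S = u}"
      and h: "h \<in> {h \<in> movers D x y. restrict (\<alpha> h) S = u}"
    have "\<alpha> g Y = \<alpha> h Y" if "Y \<in> S" for Y
    proof -
      have "restrict (\<alpha> g) S Y = restrict (\<alpha> h) S Y"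
        using g h by simp
      then show ?thesis
        using that by simp
    qed
    then show "inv g \<otimes> h \<in> {g \<in> carrier G. \<forall>Y\<in>S. \<alpha> g Y = Y}"
      using g h mem by (auto simp: movers_def intro!: action_inv_mult)
  qed
qed

text \<open>Positions are injective, so at most \<open>m\<close> separators have position below
  \<open>m\<close> from a given end; discarding them at both ends costs at most
  \<open>2 * m\<close>.\<close>

lemma deep_subset:
  assumes X: "X \<in> \<M>" and Z: "Z \<in> \<M>" and card: "2 * m + n \<le> card (separators X Z)"
  obtains S where "S \<subseteq> separators X Z" "finite S" "card S = n"
    "\<And>W. W \<in> S \<Longrightarrow> m \<le> card (separators X W)" "\<And>W. W \<in> S \<Longrightarrow> m \<le> card (separators Z W)"
proof -
  define shallow where "shallow X Z = {W \<in> separators X Z. card (separators X W) < m}" for X Z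
  have shallow: "finite (shallow X Z)" "card (shallow X Z) \<le> m" if "X \<in> \<M>" "Z \<in> \<M>" for X Z
  proof -
    have "inj_on (\<lambda>W. card (separators X W)) (shallow X Z)"
      using inj_on_card_separators[OF that] by (rule inj_on_subset) (auto simp: shallow_def)
    moreover have "\<forall>W\<in>shallow X Z. card (separators X W) < m"
      by (simp add: shallow_def)
    ultimately show "finite (shallow X Z)" "card (shallow X Z) \<le> m"
      by (rule card_inj_nat_less)+
  qed
  let ?deep = "separators X Z - (shallow X Z \<union> shallow Z X)"
  have "card (shallow X Z \<union> shallow Z X) \<le> 2 * m"
    using card_Un_le[of "shallow X Z" "shallow Z X"] shallow(2)[OF X Z] shallow(2)[OF Z X] by linarith
  then have "n \<le> card ?deep"
    using diff_card_le_card_Diff[of "shallow X Z \<union> shallow Z X" "separators X Z"] card shallow X Z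
    by simp
  then obtain S where S: "S \<subseteq> ?deep" "card S = n" "finite S"
    by (rule obtain_subset_with_card_n)
  show thesis
    by (rule that[of S]) (use S in \<open>auto simp: shallow_def separators_commute[of Z X]\<close>)
qed

section \<open>Arbitrary points of the quasi-tree and the choice of constants\<close>

lemma close_incl:
  assumes z: "z \<in> realization QT"
  obtains x where "x \<in> disjoint_union \<Y>" "path_dist QT z (qt_incl x) \<le> real K"
  using z
proof (cases rule: qt_realization_cases)
  case (incl x)
  then show thesis
    using that[of x] z by simp
next
  case (bridge u w t)
  have "path_dist QT z (qt_incl (vertex_point u)) \<le> \<bar>t - 0\<bar>"
    using path_dist_edge[of "Bridge u w" QT t 0] bridge by simp
  then show thesis
    using that[of "vertex_point u"] bridge_vertex_point(1)[OF bridge(1)] bridge by simp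
qed

text \<open>Replacing a point by one within \<open>K\<close> changes its displacement by at most
  \<open>2 * K\<close>, since the images stay within \<open>K\<close> as well.\<close>

lemma qt_movers_subset:
  assumes x: "x \<in> realization QT" and y: "y \<in> realization QT"
    and x': "x' \<in> disjoint_union \<Y>" "path_dist QT x (qt_incl x') \<le> real K"
    and y': "y' \<in> disjoint_union \<Y>" "path_dist QT y (qt_incl y') \<le> real K"
  shows "{h \<in> carrier G. path_dist QT x (\<psi> h x) \<le> D \<and> path_dist QT y (\<psi> h y) \<le> D}
    \<subseteq> movers (D + 2 * real K) x' y'"
proof -
  have "qdist z' (\<phi> h z') \<le> D + 2 * real K"
    if h: "h \<in> carrier G" and z: "z \<in> realization QT" and z': "z' \<in> disjoint_union \<Y>"
      and d: "path_dist QT z (qt_incl z') \<le> real K" "path_dist QT z (\<psi> h z) \<le> D" for h z z'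
  proof -
    let ?z' = "qt_incl z'"
    have real: "?z' \<in> realization QT" "\<psi> h z \<in> realization QT" "\<psi> h ?z' \<in> realization QT"
      using qt_incl_in_realization[OF z'] qt_action_closed[OF h] z by auto
    have "path_dist QT ?z' (\<psi> h ?z') \<le> path_dist QT ?z' z + path_dist QT z (\<psi> h ?z')"
      by (intro QT.path_dist_triangle real z)
    moreover have "path_dist QT z (\<psi> h ?z') \<le> path_dist QT z (\<psi> h z) + path_dist QT (\<psi> h z) (\<psi> h ?z')"
      by (intro QT.path_dist_triangle real z)
    moreover have "path_dist QT (\<psi> h z) (\<psi> h ?z') = path_dist QT z ?z'"
      by (intro qt_action_isometry h z real)
    ultimately show ?thesis
      using d by (simp add: qt_action_incl z' path_dist_commute[of QT ?z' z])
  qed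
  from this[OF _ x x'] this[OF _ y y'] show ?thesis
    by (auto simp: movers_def)
qed

theorem acylindrical_qt:
  assumes acyl: "uniformly_acylindrical (members \<Y>) (\<lambda>Y. stabilizer G \<alpha> Y)
      (\<lambda>Y. realization (graph \<Y> Y)) (\<lambda>Y. path_dist (graph \<Y> Y)) (\<lambda>Y h x. snd (\<phi> h (Y, x)))"
    and stab: "\<forall>S \<subseteq> members \<Y>. finite S \<and> card S = N \<longrightarrow>
      finite {g \<in> carrier G. \<forall>Y\<in>S. \<alpha> g Y = Y} \<and> card {g \<in> carrier G. \<forall>Y\<in>S. \<alpha> g Y = Y} \<le> B"
  shows "acylindrical_action G (realization QT) (path_dist QT) \<psi>"
  unfolding acylindrical_action_def
proof (rule conjI[OF isometric_action_qt])
  have "\<exists>L>0. \<exists>B'>0. \<forall>x\<in>realization QT. \<forall>y\<in>realization QT. L \<le> path_dist QT x y \<longrightarrow>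
      finite {h \<in> carrier G. path_dist QT x (\<psi> h x) \<le> D \<and> path_dist QT y (\<psi> h y) \<le> D} \<and>
      card {h \<in> carrier G. path_dist QT x (\<psi> h x) \<le> D \<and> path_dist QT y (\<psi> h y) \<le> D} \<le> B'"
    if D: "D > 0" for D :: real
  proof -
    \<comment> \<open>Displacement that remains after both endpoints are moved into the disjoint
      union.\<close>
    define E where "E = D + 2 * real K"
    have E: "E > 0"
      using D by (simp add: E_def)
    \<comment> \<open>This is the displacement bound of \<open>large_projection_case\<close> for
      movers by \<open>E\<close>; the uniform constants of the stabilizers are taken for it.\<close>
    then have "2 * E + 2 * real \<theta> > 0"
      by (simp add: add_pos_nonneg)
    then obtain L C where L: "L > 0" and C: "\<And>W a b. \<lbrakk>W \<in> \<M>; a \<in> realization (graph \<Y> W);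
        b \<in> realization (graph \<Y> W); L \<le> path_dist (graph \<Y> W) a b\<rbrakk>
      \<Longrightarrow> finite {h \<in> stabilizer G \<alpha> W. path_dist (graph \<Y> W) a (snd (\<phi> h (W, a))) \<le> 2 * E + 2 * real \<theta> \<and>
            path_dist (graph \<Y> W) b (snd (\<phi> h (W, b))) \<le> 2 * E + 2 * real \<theta>}
        \<and> card {h \<in> stabilizer G \<alpha> W. path_dist (graph \<Y> W) a (snd (\<phi> h (W, a))) \<le> 2 * E + 2 * real \<theta> \<and>
            path_dist (graph \<Y> W) b (snd (\<phi> h (W, b))) \<le> 2 * E + 2 * real \<theta>} \<le> C"
      using acyl unfolding uniformly_acylindrical_def by meson
    \<comment> \<open>Threshold of \<open>large_projection_case\<close> for \<open>E\<close>; if no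
      member exceeds it, \<open>qdist_le\<close> applies with this \<open>R\<close>.\<close>
    define R where "R = real K + 2 * (E + 2 * real \<theta>) + (L + 2 * real \<theta>)"
    \<comment> \<open>A position of at least \<open>m\<close> exceeds \<open>2 * E\<close>, the
      depth that \<open>separators_movers\<close> demands.\<close>
    define m where "m = nat \<lfloor>2 * E\<rfloor> + 1"
    \<comment> \<open>The bound of \<open>qdist_le\<close> for \<open>2 * m + N\<close> separators.
      Beyond it there are enough of them to discard \<open>m\<close> at each end and keep
      \<open>N\<close>.\<close>
    define far where "far = 2 ^ (2 * m + N) * (2 * R + real K)"
    \<comment> \<open>The two cases are covered by a sum; the final 1 keeps the constant
      positive.\<close>
    define B' where "B' = window_card E * C + window_card E ^ N * B + 1"
    have R: "real \<theta> \<le> R"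
      using E L by (simp add: R_def)
    have m: "2 * E < real m"
      unfolding m_def by linarith
    have far_nonneg: "0 \<le> far"
      using R by (simp add: far_def)
    have bound: "finite (movers E x y) \<and> card (movers E x y) \<le> B'"
      if x: "x \<in> disjoint_union \<Y>" and y: "y \<in> disjoint_union \<Y>" and xy: "far < qdist x y" for x y
    proof (cases "\<exists>W\<in>\<M>. ennreal R < pdist W x y")
      case True
      then obtain W where W: "W \<in> \<M>" "ennreal R < pdist W x y"
        by blast
      have "finite (movers E x y) \<and> card (movers E x y) \<le> window_card E * C"
        by (rule large_projection_case[OF x y W(1) _ _ W(2)[unfolded R_def] C[OF W(1)]])
          (use E L in auto)
      then show ?thesis
        by (simp add: B'_def)
    next
      case False
      have mem: "fst x \<in> \<M>" "fst y \<in> \<M>"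
        using x y by (auto simp: disjoint_union_iff)
      have "2 * m + N \<le> card (separators (fst x) (fst y))"
      proof (rule ccontr)
        assume "\<not> ?thesis"
        then have "qdist x y \<le> far"
          unfolding far_def using False by (intro qdist_le[OF R x y]) (auto simp: not_less)
        then show False
          using xy by simp
      qed
      then obtain S where S: "S \<subseteq> separators (fst x) (fst y)" "finite S" "card S = N"
        "\<And>W. W \<in> S \<Longrightarrow> m \<le> card (separators (fst x) W)" "\<And>W. W \<in> S \<Longrightarrow> m \<le> card (separators (fst y) W)"
        using deep_subset[OF mem] by metis
      have deep: "2 * E < real n" if "m \<le> n" for n
        using that m by linarith
      have "S \<subseteq> \<M>"
        using S(1) by (auto simp: separators_def)
      then have "finite {g \<in> carrier G. \<forall>Y\<in>S. \<alpha> g Y = Y} \<and> card {g \<in> carrier G. \<forall>Y\<in>S. \<alpha> g Y = Y} \<le> B"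
        using stab S(2,3) by blast
      then have "finite (movers E x y) \<and> card (movers E x y) \<le> window_card E ^ card S * B"
        using S by (intro many_separators_case x y deep) auto
      then show ?thesis
        by (simp add: B'_def S(3))
    qed
    \<comment> \<open>Each endpoint is moved by at most \<open>K\<close> into the disjoint union;
      the extra 1 makes the comparison with \<open>far\<close> strict.\<close>
    show ?thesis
    proof (intro exI[of _ "far + 2 * real K + 1"] exI[of _ B'] conjI ballI impI)
      fix x y assume x: "x \<in> realization QT" and y: "y \<in> realization QT"
        and xy: "far + 2 * real K + 1 \<le> path_dist QT x y"
      obtain x' where x': "x' \<in> disjoint_union \<Y>" "path_dist QT x (qt_incl x') \<le> real K"
        using x by (rule close_incl)
      obtain y' where y': "y' \<in> disjoint_union \<Y>" "path_dist QT y (qt_incl y') \<le> real K"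
        using y by (rule close_incl)
      have "path_dist QT x y \<le> path_dist QT x (qt_incl x') + path_dist QT (qt_incl x') y"
        by (intro QT.path_dist_triangle x y qt_incl_in_realization x')
      moreover have "path_dist QT (qt_incl x') y \<le> qdist x' y' + path_dist QT (qt_incl y') y"
        by (intro QT.path_dist_triangle x y qt_incl_in_realization x' y')
      ultimately have "far < qdist x' y'"
        using xy x'(2) y'(2) by (simp add: path_dist_commute[of QT _ y])
      then have fin: "finite (movers E x' y')" "card (movers E x' y') \<le> B'"
        using bound[OF x'(1) y'(1)] by auto
      have sub: "{h \<in> carrier G. path_dist QT x (\<psi> h x) \<le> D \<and> path_dist QT y (\<psi> h y) \<le> D} \<subseteq> movers E x' y'"
        unfolding E_def by (rule qt_movers_subset[OF x y x' y'])
      show "finite {h \<in> carrier G. path_dist QT x (\<psi> h x) \<le> D \<and> path_dist QT y (\<psi> h y) \<le> D}"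
        using sub fin(1) by (rule finite_subset)
      show "card {h \<in> carrier G. path_dist QT x (\<psi> h x) \<le> D \<and> path_dist QT y (\<psi> h y) \<le> D} \<le> B'"
        using card_mono[OF fin(1) sub] fin(2) by (rule order_trans)
    qed (use far_nonneg in \<open>simp_all add: B'_def add_nonneg_pos\<close>)
  qed
  then show "uniformly_acylindrical {()} (\<lambda>_. carrier G) (\<lambda>_. realization QT) (\<lambda>_. path_dist QT) (\<lambda>_. \<psi>)"
    unfolding uniformly_acylindrical_def by simp
qed

end

theorem theorem6p4:
  fixes G :: "('g, 'm) monoid_scheme"
    and \<Y> :: "('i, 'v, 'e) graph_family"
    and \<alpha> :: "'g \<Rightarrow> 'i \<Rightarrow> 'i"
    and \<phi> :: "'g \<Rightarrow> 'i \<times> ('v, 'e) point \<Rightarrow> 'i \<times> ('v, 'e) point"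
    and \<theta> K N B :: nat
  assumes "projection_family \<Y> \<theta>"
    and "K > 0" and "K \<ge> 4 * \<theta>"
    and "group G"
    and "projection_family_action G \<Y> \<alpha> \<phi>"
    and "uniformly_acylindrical (members \<Y>) (\<lambda>Y. stabilizer G \<alpha> Y)
           (\<lambda>Y. realization (graph \<Y> Y)) (\<lambda>Y. path_dist (graph \<Y> Y))
           (\<lambda>Y h x. snd (\<phi> h (Y, x)))"
    and "\<forall>S \<subseteq> members \<Y>. finite S \<and> card S = N \<longrightarrow>
           finite {g \<in> carrier G. \<forall>Y\<in>S. \<alpha> g Y = Y} \<and>
           card {g \<in> carrier G. \<forall>Y\<in>S. \<alpha> g Y = Y} \<le> B"
  shows "acylindrical_action G (realization (quasi_tree \<Y> K)) (path_dist (quasi_tree \<Y> K))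
           (qt_action \<Y> K \<phi>)"
proof -
  interpret quasi_tree_action G \<Y> \<alpha> \<phi> \<theta> K
    using assms(1-5) by (intro quasi_tree_action.intro quasi_tree_of_spaces.intro
        quasi_tree_of_spaces_axioms.intro)
  show ?thesis
    using assms(6,7) by (rule acylindrical_qt)
qed

end
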